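(* Let $m,r>0$, let $\mathbb{I}=\mathrm{diag}(I_1,I_2,I_3)$ with $I_1,I_2,I_3>0$, and let $E$ be the $3\times 3$ identity matrix. On $\mathcal{R}=S^2\times\mathbb{R}^3$, with elements $(\gamma,K)$, $\|\gamma\|=1$, let $\Omega=\Omega(\gamma,K)\in\mathbb{R}^3$ be determined by $K=(\mathbb{I}+mr^2E)\Omega-mr^2(\Omega\cdot\gamma)\gamma$, and consider the almost Poisson bracket $$\{f,g\}'_{\mathrm{Rank}2}=-\bigl(K-mr^2(\Omega\cdot\gamma)\gamma\bigr)\cdot\left(\frac{\partial f}{\partial K}\times\frac{\partial g}{\partial K}\right)-\gamma\cdot\left(\frac{\partial f}{\partial K}\times\frac{\partial g}{\partial\gamma}-\frac{\partial g}{\partial K}\times\frac{\partial f}{\partial\gamma}\right).$$ Then $\{\cdot,\cdot\}'_{\mathrm{Rank}2}$ is a $\phi$-twisted Poisson bracket with $\phi=-d\mathcal{B}$, where $$\mathcal{B}=mr^2(\Omega\cdot\gamma)\,\sigma$$ and $\sigma$ denotes the area form of the sphere $\|\gamma\|=1$.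
   Context: An almost Poisson bracket is a skew-symmetric bilinear bracket on smooth functions satisfying the Leibniz rule (not necessarily the Jacobi identity). The formula is written in the redundant coordinates $(\gamma,K)\in\mathbb{R}^3\times\mathbb{R}^3$; since $\|\gamma\|^2$ is a Casimir function, it restricts to $\mathcal{R}=\{\|\gamma\|=1\}=S^2\times\mathbb{R}^3$. The area form $\sigma$ (pulled back to $\mathcal{R}$) is $\sigma=\frac12\gamma\cdot(d\gamma\times d\gamma)$, i.e. $\sigma(u,v)=\gamma\cdot(u\times v)$ for $u,v\in T_\gamma S^2$. Twisted Poisson. For a bracket $\{\cdot,\cdot\}$ on a manifold $P$, the associated bivector field $\pi$ satisfies $\pi(df,dg)=\{f,g\}$, and $\pi^\sharp:T^*P\to TP$ is given by $\beta(\pi^\sharp(\alpha))=\pi(\alpha,\beta)$. For a closed 3-form $\phi$ on $P$, the $\phi$-twisted Courant bracket on $\Gamma(TP\oplus T^*P)$ is $[\![(X,\alpha),(Y,\beta)]\!]_\phi=([X,Y],\mathcal{L}_X\beta-\mathbf{i}_Yd\alpha+\mathbf{i}_{X\wedge Y}\phi)$, with $\mathbf{i}_{X\wedge Y}\phi=\phi(X,Y,\cdot)$. The bracket (or $\pi$) is $\phi$-twisted Poisson if $L_\pi=\{(\pi^\sharp(\alpha),\alpha)\}\subset TP\oplus T^*P$ satisfies $[\![\Gamma(L_\pi),\Gamma(L_\pi)]\!]_\phi\subseteq\Gamma(L_\pi)$. *)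

theory Defs
  imports "HOL-Analysis.Analysis"
begin

section \<open>Smooth maps and vector fields on a submanifold of a Euclidean space\<close>

fun times_differentiable_on ::
  "nat \<Rightarrow> 'a::real_normed_vector set \<Rightarrow> ('a \<Rightarrow> 'b::real_normed_vector) \<Rightarrow> bool" where
  "times_differentiable_on 0 U f \<longleftrightarrow> continuous_on U f"
| "times_differentiable_on (Suc k) U f \<longleftrightarrow>
     (\<forall>x\<in>U. f differentiable (at x)) \<and>
     (\<forall>v. times_differentiable_on k U (\<lambda>x. frechet_derivative f (at x) v))"

text \<open>Class C-infinity; meant for open \<open>U\<close> and finite-dimensional domains.\<close>

definition smooth_on :: "'a::real_normed_vector set \<Rightarrow> ('a \<Rightarrow> 'b::real_normed_vector) \<Rightarrow> bool" where
  "smooth_on U f \<longleftrightarrow> (\<forall>k. times_differentiable_on k U f)"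

text \<open>
  In what follows \<open>M\<close> stands for an embedded submanifold of a Euclidean space. Functions, vector
  fields and forms on \<open>M\<close> are represented by functions on the whole ambient type, of which only the
  values at points of \<open>M\<close> (and, for forms, on tangent vectors) are meaningful. A map on \<open>M\<close> is
  smooth if it is the restriction of a smooth map on an open neighbourhood of \<open>M\<close>; by partitions of
  unity this is the same as having smooth extensions locally.
\<close>

definition smooth_extension_of ::
  "'a::euclidean_space set \<Rightarrow> ('a \<Rightarrow> 'b::real_normed_vector) \<Rightarrow> ('a \<Rightarrow> 'b) \<Rightarrow> bool" where
  "smooth_extension_of M f F \<longleftrightarrow>
     (\<exists>U. open U \<and> M \<subseteq> U \<and> smooth_on U F) \<and> (\<forall>x\<in>M. F x = f x)"

definition smooth_map :: "'a::euclidean_space set \<Rightarrow> ('a \<Rightarrow> 'b::real_normed_vector) \<Rightarrow> bool" where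
  "smooth_map M f \<longleftrightarrow> (\<exists>F. smooth_extension_of M f F)"

definition tangent_space :: "'a::euclidean_space set \<Rightarrow> 'a \<Rightarrow> 'a set" where
  "tangent_space M p =
     {v. \<exists>c e. 0 < e \<and> smooth_on {-e<..<e} c \<and> c ` {-e<..<e} \<subseteq> M \<and> c 0 = p \<and>
           (c has_vector_derivative v) (at (0::real))}"

definition vector_field :: "'a::euclidean_space set \<Rightarrow> ('a \<Rightarrow> 'a) \<Rightarrow> bool" where
  "vector_field M X \<longleftrightarrow> smooth_map M X \<and> (\<forall>p\<in>M. X p \<in> tangent_space M p)"

text \<open>
  Derivative along \<open>M\<close> in the direction of a tangent vector \<open>v\<close>. A derivative within \<open>M\<close> is not
  unique as a linear map on the ambient space, but its value on tangent vectors is.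
\<close>

definition deriv_along ::
  "'a::euclidean_space set \<Rightarrow> 'a \<Rightarrow> 'a \<Rightarrow> ('a \<Rightarrow> 'b::real_normed_vector) \<Rightarrow> 'b" where
  "deriv_along M p v f = frechet_derivative f (at p within M) v"

definition lie_bracket :: "'a::euclidean_space set \<Rightarrow> ('a \<Rightarrow> 'a) \<Rightarrow> ('a \<Rightarrow> 'a) \<Rightarrow> 'a \<Rightarrow> 'a" where
  "lie_bracket M X Y p = deriv_along M p (X p) Y - deriv_along M p (Y p) X"

section \<open>Differential forms\<close>

text \<open>Covectors are extensional, so that covectors equal on the tangent space are equal.\<close>

definition cotangent_space :: "'a::euclidean_space set \<Rightarrow> 'a \<Rightarrow> ('a \<Rightarrow> real) set" where
  "cotangent_space M p =
     {a \<in> extensional (tangent_space M p).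
        (\<forall>u\<in>tangent_space M p. \<forall>v\<in>tangent_space M p. a (u + v) = a u + a v) \<and>
        (\<forall>c. \<forall>u\<in>tangent_space M p. a (c *\<^sub>R u) = c * a u)}"

definition one_form :: "'a::euclidean_space set \<Rightarrow> ('a \<Rightarrow> 'a \<Rightarrow> real) \<Rightarrow> bool" where
  "one_form M \<alpha> \<longleftrightarrow>
     (\<forall>p\<in>M. \<alpha> p \<in> cotangent_space M p) \<and>
     (\<forall>X. vector_field M X \<longrightarrow> smooth_map M (\<lambda>p. \<alpha> p (X p)))"

definition three_form :: "'a::euclidean_space set \<Rightarrow> ('a \<Rightarrow> 'a \<Rightarrow> 'a \<Rightarrow> 'a \<Rightarrow> real) \<Rightarrow> bool" where
  "three_form M \<phi> \<longleftrightarrow>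
     (\<forall>p\<in>M. \<forall>u\<in>tangent_space M p. \<forall>u'\<in>tangent_space M p.
        \<forall>v\<in>tangent_space M p. \<forall>w\<in>tangent_space M p.
          \<phi> p (u + u') v w = \<phi> p u v w + \<phi> p u' v w \<and>
          (\<forall>c. \<phi> p (c *\<^sub>R u) v w = c * \<phi> p u v w) \<and>
          \<phi> p v u w = - \<phi> p u v w \<and>
          \<phi> p u w v = - \<phi> p u v w) \<and>
     (\<forall>X Y Z. vector_field M X \<and> vector_field M Y \<and> vector_field M Z \<longrightarrow>
        smooth_map M (\<lambda>p. \<phi> p (X p) (Y p) (Z p)))"

definition differential :: "'a::euclidean_space set \<Rightarrow> ('a \<Rightarrow> real) \<Rightarrow> 'a \<Rightarrow> 'a \<Rightarrow> real" where
  "differential M f p = (\<lambda>v\<in>tangent_space M p. deriv_along M p v f)"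

text \<open>
  The Lie derivative and the exterior derivative are given by their invariant formulas (with no
  factorial factors, so \<open>d\<alpha>(X,Y) = X(\<alpha>(Y)) - Y(\<alpha>(X)) - \<alpha>([X,Y])\<close>). These are tensorial, so
  their values do not depend on the vector fields chosen to extend the given tangent vectors.
\<close>

definition field_through :: "'a::euclidean_space set \<Rightarrow> 'a \<Rightarrow> 'a \<Rightarrow> 'a \<Rightarrow> 'a" where
  "field_through M p v = (SOME Z. vector_field M Z \<and> Z p = v)"

definition lie_deriv1 ::
  "'a::euclidean_space set \<Rightarrow> ('a \<Rightarrow> 'a) \<Rightarrow> ('a \<Rightarrow> 'a \<Rightarrow> real) \<Rightarrow> 'a \<Rightarrow> 'a \<Rightarrow> real" where
  "lie_deriv1 M X \<beta> p v =
     (let Z = field_through M p v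
      in deriv_along M p (X p) (\<lambda>x. \<beta> x (Z x)) - \<beta> p (lie_bracket M X Z p))"

definition ext_deriv1 ::
  "'a::euclidean_space set \<Rightarrow> ('a \<Rightarrow> 'a \<Rightarrow> real) \<Rightarrow> 'a \<Rightarrow> 'a \<Rightarrow> 'a \<Rightarrow> real" where
  "ext_deriv1 M \<alpha> p u v =
     (let X = field_through M p u; Y = field_through M p v
      in deriv_along M p u (\<lambda>x. \<alpha> x (Y x)) - deriv_along M p v (\<lambda>x. \<alpha> x (X x))
         - \<alpha> p (lie_bracket M X Y p))"

definition ext_deriv2 ::
  "'a::euclidean_space set \<Rightarrow> ('a \<Rightarrow> 'a \<Rightarrow> 'a \<Rightarrow> real) \<Rightarrow> 'a \<Rightarrow> 'a \<Rightarrow> 'a \<Rightarrow> 'a \<Rightarrow> real" where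
  "ext_deriv2 M \<omega> p u v w =
     (let X = field_through M p u; Y = field_through M p v; Z = field_through M p w
      in deriv_along M p u (\<lambda>x. \<omega> x (Y x) (Z x))
         - deriv_along M p v (\<lambda>x. \<omega> x (X x) (Z x))
         + deriv_along M p w (\<lambda>x. \<omega> x (X x) (Y x))
         - \<omega> p (lie_bracket M X Y p) w
         + \<omega> p (lie_bracket M X Z p) v
         - \<omega> p (lie_bracket M Y Z p) u)"

definition ext_deriv3 ::
  "'a::euclidean_space set \<Rightarrow> ('a \<Rightarrow> 'a \<Rightarrow> 'a \<Rightarrow> 'a \<Rightarrow> real) \<Rightarrow> 'a \<Rightarrow> 'a \<Rightarrow> 'a \<Rightarrow> 'a \<Rightarrow> 'a \<Rightarrow> real" where
  "ext_deriv3 M \<phi> p s u v w =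
     (let W = field_through M p s; X = field_through M p u;
          Y = field_through M p v; Z = field_through M p w
      in deriv_along M p s (\<lambda>x. \<phi> x (X x) (Y x) (Z x))
         - deriv_along M p u (\<lambda>x. \<phi> x (W x) (Y x) (Z x))
         + deriv_along M p v (\<lambda>x. \<phi> x (W x) (X x) (Z x))
         - deriv_along M p w (\<lambda>x. \<phi> x (W x) (X x) (Y x))
         - \<phi> p (lie_bracket M W X p) v w
         + \<phi> p (lie_bracket M W Y p) u w
         - \<phi> p (lie_bracket M W Z p) u v
         - \<phi> p (lie_bracket M X Y p) s w
         + \<phi> p (lie_bracket M X Z p) s v
         - \<phi> p (lie_bracket M Y Z p) s u)"

definition closed_three_form ::
  "'a::euclidean_space set \<Rightarrow> ('a \<Rightarrow> 'a \<Rightarrow> 'a \<Rightarrow> 'a \<Rightarrow> real) \<Rightarrow> bool" where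
  "closed_three_form M \<phi> \<longleftrightarrow>
     three_form M \<phi> \<and>
     (\<forall>p\<in>M. \<forall>s\<in>tangent_space M p. \<forall>u\<in>tangent_space M p.
        \<forall>v\<in>tangent_space M p. \<forall>w\<in>tangent_space M p. ext_deriv3 M \<phi> p s u v w = 0)"

section \<open>Almost Poisson and twisted Poisson brackets\<close>

text \<open>
  The first condition says that the bracket is an operation on functions on \<open>M\<close>, i.e. does not see
  the values of its arguments outside \<open>M\<close>. Linearity and the Leibniz rule in the second argument
  follow from skew-symmetry.
\<close>

definition almost_poisson ::
  "'a::euclidean_space set \<Rightarrow> (('a \<Rightarrow> real) \<Rightarrow> ('a \<Rightarrow> real) \<Rightarrow> 'a \<Rightarrow> real) \<Rightarrow> bool" where
  "almost_poisson M br \<longleftrightarrow>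
     (\<forall>f f' g g'. smooth_map M f \<and> smooth_map M g \<and> (\<forall>p\<in>M. f p = f' p \<and> g p = g' p) \<longrightarrow>
        (\<forall>p\<in>M. br f g p = br f' g' p)) \<and>
     (\<forall>f g. smooth_map M f \<and> smooth_map M g \<longrightarrow>
        smooth_map M (br f g) \<and> (\<forall>p\<in>M. br g f p = - br f g p)) \<and>
     (\<forall>f g h c. smooth_map M f \<and> smooth_map M g \<and> smooth_map M h \<longrightarrow>
        (\<forall>p\<in>M. br (\<lambda>x. f x + g x) h p = br f h p + br g h p \<and>
               br (\<lambda>x. c * f x) h p = c * br f h p \<and>
               br (\<lambda>x. f x * g x) h p = f p * br g h p + g p * br f h p))"

definition bivector_field ::
  "'a::euclidean_space set \<Rightarrow> ('a \<Rightarrow> ('a \<Rightarrow> real) \<Rightarrow> ('a \<Rightarrow> real) \<Rightarrow> real) \<Rightarrow> bool" where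
  "bivector_field M \<pi> \<longleftrightarrow>
     (\<forall>p\<in>M. \<forall>a\<in>cotangent_space M p. \<forall>a'\<in>cotangent_space M p. \<forall>b\<in>cotangent_space M p.
        \<pi> p (\<lambda>v\<in>tangent_space M p. a v + a' v) b = \<pi> p a b + \<pi> p a' b \<and>
        (\<forall>c. \<pi> p (\<lambda>v\<in>tangent_space M p. c * a v) b = c * \<pi> p a b) \<and>
        \<pi> p b a = - \<pi> p a b) \<and>
     (\<forall>\<alpha> \<beta>. one_form M \<alpha> \<and> one_form M \<beta> \<longrightarrow> smooth_map M (\<lambda>p. \<pi> p (\<alpha> p) (\<beta> p)))"

definition associated_bivector ::
  "'a::euclidean_space set \<Rightarrow> (('a \<Rightarrow> real) \<Rightarrow> ('a \<Rightarrow> real) \<Rightarrow> 'a \<Rightarrow> real)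
     \<Rightarrow> ('a \<Rightarrow> ('a \<Rightarrow> real) \<Rightarrow> ('a \<Rightarrow> real) \<Rightarrow> real) \<Rightarrow> bool" where
  "associated_bivector M br \<pi> \<longleftrightarrow>
     bivector_field M \<pi> \<and>
     (\<forall>f g. smooth_map M f \<and> smooth_map M g \<longrightarrow>
        (\<forall>p\<in>M. \<pi> p (differential M f p) (differential M g p) = br f g p))"

definition sharp ::
  "'a::euclidean_space set \<Rightarrow> ('a \<Rightarrow> ('a \<Rightarrow> real) \<Rightarrow> ('a \<Rightarrow> real) \<Rightarrow> real)
     \<Rightarrow> 'a \<Rightarrow> ('a \<Rightarrow> real) \<Rightarrow> 'a" where
  "sharp M \<pi> p a =
     (THE v. v \<in> tangent_space M p \<and> (\<forall>b\<in>cotangent_space M p. b v = \<pi> p a b))"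

definition graph_sections ::
  "'a::euclidean_space set \<Rightarrow> ('a \<Rightarrow> ('a \<Rightarrow> real) \<Rightarrow> ('a \<Rightarrow> real) \<Rightarrow> real)
     \<Rightarrow> (('a \<Rightarrow> 'a) \<times> ('a \<Rightarrow> 'a \<Rightarrow> real)) set" where
  "graph_sections M \<pi> =
     {(X, \<alpha>). vector_field M X \<and> one_form M \<alpha> \<and> (\<forall>p\<in>M. X p = sharp M \<pi> p (\<alpha> p))}"

definition twisted_courant_bracket ::
  "'a::euclidean_space set \<Rightarrow> ('a \<Rightarrow> 'a \<Rightarrow> 'a \<Rightarrow> 'a \<Rightarrow> real)
     \<Rightarrow> ('a \<Rightarrow> 'a) \<times> ('a \<Rightarrow> 'a \<Rightarrow> real) \<Rightarrow> ('a \<Rightarrow> 'a) \<times> ('a \<Rightarrow> 'a \<Rightarrow> real)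
     \<Rightarrow> ('a \<Rightarrow> 'a) \<times> ('a \<Rightarrow> 'a \<Rightarrow> real)" where
  "twisted_courant_bracket M \<phi> = (\<lambda>(X, \<alpha>) (Y, \<beta>).
     (lie_bracket M X Y,
      \<lambda>p. \<lambda>v\<in>tangent_space M p.
        lie_deriv1 M X \<beta> p v - ext_deriv1 M \<alpha> p (Y p) v + \<phi> p (X p) (Y p) v))"

text \<open>The associated bivector field of an almost Poisson bracket is unique at points of \<open>M\<close>.\<close>

definition twisted_poisson ::
  "'a::euclidean_space set \<Rightarrow> (('a \<Rightarrow> real) \<Rightarrow> ('a \<Rightarrow> real) \<Rightarrow> 'a \<Rightarrow> real)
     \<Rightarrow> ('a \<Rightarrow> 'a \<Rightarrow> 'a \<Rightarrow> 'a \<Rightarrow> real) \<Rightarrow> bool" where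
  "twisted_poisson M br \<phi> \<longleftrightarrow>
     almost_poisson M br \<and> closed_three_form M \<phi> \<and>
     (\<exists>\<pi>. associated_bivector M br \<pi> \<and>
        (\<forall>s\<in>graph_sections M \<pi>. \<forall>t\<in>graph_sections M \<pi>.
           twisted_courant_bracket M \<phi> s t \<in> graph_sections M \<pi>))"

section \<open>The bracket\<close>

text \<open>Points and tangent vectors are pairs with components \<open>(\<gamma>, K)\<close>.\<close>

type_synonym phase = "(real^3) \<times> (real^3)"

definition phase_space :: "phase set" where
  "phase_space = {p. norm (fst p) = 1}"

definition diag_matrix :: "real^3 \<Rightarrow> real^3^3" where
  "diag_matrix d = (\<chi> i j. if i = j then d $ i else 0)"

definition angular_velocity :: "real \<Rightarrow> real \<Rightarrow> real^3 \<Rightarrow> phase \<Rightarrow> real^3" where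
  "angular_velocity m r I p =
     (THE w. snd p = (diag_matrix I + (m * r\<^sup>2) *\<^sub>R mat 1) *v w
                     - (m * r\<^sup>2 * (w \<bullet> fst p)) *\<^sub>R fst p)"

definition grad_gamma :: "(phase \<Rightarrow> real) \<Rightarrow> phase \<Rightarrow> real^3" where
  "grad_gamma F p = (\<chi> i. frechet_derivative F (at p) (axis i 1, 0))"

definition grad_K :: "(phase \<Rightarrow> real) \<Rightarrow> phase \<Rightarrow> real^3" where
  "grad_K F p = (\<chi> i. frechet_derivative F (at p) (0, axis i 1))"

text \<open>The formula in the redundant coordinates, for functions of \<open>(\<gamma>, K)\<close> in the ambient space.\<close>

definition rank2_formula ::
  "real \<Rightarrow> real \<Rightarrow> real^3 \<Rightarrow> (phase \<Rightarrow> real) \<Rightarrow> (phase \<Rightarrow> real) \<Rightarrow> phase \<Rightarrow> real" where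
  "rank2_formula m r I F G p =
     (let \<gamma> = fst p; K = snd p; \<Omega> = angular_velocity m r I p
      in - ((K - (m * r\<^sup>2 * (\<Omega> \<bullet> \<gamma>)) *\<^sub>R \<gamma>) \<bullet> cross3 (grad_K F p) (grad_K G p))
         - \<gamma> \<bullet> (cross3 (grad_K F p) (grad_gamma G p) - cross3 (grad_K G p) (grad_gamma F p)))"

text \<open>
  The bracket of functions on the phase space is the formula applied to smooth extensions; since the
  squared norm of \<open>\<gamma>\<close> is a Casimir, the choice of the extensions is immaterial on the phase space.
\<close>

definition rank2_bracket ::
  "real \<Rightarrow> real \<Rightarrow> real^3 \<Rightarrow> (phase \<Rightarrow> real) \<Rightarrow> (phase \<Rightarrow> real) \<Rightarrow> phase \<Rightarrow> real" where
  "rank2_bracket m r I f g =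
     rank2_formula m r I (SOME F. smooth_extension_of phase_space f F)
                         (SOME G. smooth_extension_of phase_space g G)"

definition area_form :: "phase \<Rightarrow> phase \<Rightarrow> phase \<Rightarrow> real" where
  "area_form p u v = fst p \<bullet> cross3 (fst u) (fst v)"

definition B_form :: "real \<Rightarrow> real \<Rightarrow> real^3 \<Rightarrow> phase \<Rightarrow> phase \<Rightarrow> phase \<Rightarrow> real" where
  "B_form m r I p u v = m * r\<^sup>2 * (angular_velocity m r I p \<bullet> fst p) * area_form p u v"

end

(*
  A derivative along the phase space is determined on tangent vectors, so everything can be checked
  pointwise in the redundant coordinates. A covector on the tangent space at (gamma, K) is represented
  by an ambient vector (a_gamma, a_K), unique up to multiples of (gamma, 0), and with
  h = m r^2 (Omega . gamma) and N = K - h gamma its Hamiltonian vector is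
  (a_K x gamma, a_K x N + a_gamma x gamma). On the phase space h is linear in K,
  h = beta(gamma) . K, and as 3-forms on the tangent planes of the sphere vanish,
  dB(u, v, w) is the alternating sum of (beta . u_K) sigma(v, w); its closedness has the same reason.
  The covector part of the twisted Courant bracket of two Hamiltonian sections is then an explicit
  vector, and its Hamiltonian vector is the Lie bracket by the Jacobi identity of the cross product.
*)

theory Submission
  imports Defs
begin

text \<open>For h = 0 the formula is the minus Lie-Poisson bracket of the Euclidean Lie algebra
  e(3), restricted to unit gamma. The extra term h gamma . (f_K x g_K) equals h sigma(X_f, X_g),
  because the gamma component of X_f is f_K x gamma. So the bracket is a gauge transform of a
  Poisson bracket by the two-form B, which is where the twist -dB comes from; closure itself is
  verified directly. Two obstacles shape the argument. The Lie and exterior derivatives are defined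
  with arbitrarily chosen extension fields and arbitrary derivatives within the manifold, so each is
  first reduced to a formula from which the choices have cancelled. And closedness of dB is not
  drawn from d d = 0, which would involve second derivatives of h and their symmetry: with the
  coefficient beta in place of dh, only first derivatives of beta occur.\<close>

section \<open>Calculus of smooth maps\<close>

lemma times_differentiable_on_cong:
  assumes "open U" "\<And>x. x \<in> U \<Longrightarrow> f x = g x" "times_differentiable_on k U f"
  shows "times_differentiable_on k U g"
  using assms(2,3)
proof (induction k arbitrary: f g)
  case 0
  then show ?case by (metis continuous_on_cong times_differentiable_on.simps(1))
next
  case (Suc k)
  have d: "(g has_derivative D) (at x)" if "x \<in> U" "(f has_derivative D) (at x)" for x D
    using has_derivative_transform_within_open[OF that(2) assms(1) that(1)] Suc.prems(1) by blast
  have D: "(g has_derivative frechet_derivative f (at x)) (at x)" if "x \<in> U" for x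
    using d[OF that] Suc.prems(2) that frechet_derivative_works by fastforce
  have "frechet_derivative f (at x) = frechet_derivative g (at x)" if "x \<in> U" for x
    using frechet_derivative_at[OF D[OF that]] by simp
  then have "times_differentiable_on k U (\<lambda>x. frechet_derivative g (at x) v)" for v
    using Suc.IH[of "\<lambda>x. frechet_derivative f (at x) v" "\<lambda>x. frechet_derivative g (at x) v"]
      Suc.prems(2) by auto
  then show ?case using D by (auto simp: differentiable_def)
qed

text \<open>\<open>times_differentiable_on\<close> recurses through
  \<open>frechet_derivative\<close>. Since derivatives at a point are unique, an induction may
  supply the explicit derivative of a calculus rule instead.\<close>

lemma times_differentiable_on_SucI:
  assumes "open U" "\<And>x. x \<in> U \<Longrightarrow> (f has_derivative D x) (at x)"
    and "\<And>v. times_differentiable_on k U (\<lambda>x. D x v)"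
  shows "times_differentiable_on (Suc k) U f"
proof -
  have "D x = frechet_derivative f (at x)" if "x \<in> U" for x
    using frechet_derivative_at[OF assms(2)[OF that]] .
  then have "times_differentiable_on k U (\<lambda>x. frechet_derivative f (at x) v)" for v
    by (intro times_differentiable_on_cong[OF assms(1) _ assms(3)[of v]]) simp
  then show ?thesis using assms(2) by (auto simp: differentiable_def)
qed

lemma times_differentiable_on_SucD:
  assumes "times_differentiable_on (Suc k) U f"
  shows "x \<in> U \<Longrightarrow> (f has_derivative frechet_derivative f (at x)) (at x)"
    and "times_differentiable_on k U (\<lambda>x. frechet_derivative f (at x) v)"
  using assms by (auto simp flip: frechet_derivative_works)

lemma times_differentiable_on_pred:
  "times_differentiable_on (Suc k) U f \<Longrightarrow> times_differentiable_on k U f"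
proof (induction k arbitrary: f)
  case 0
  then show ?case
    by (simp add: continuous_at_imp_continuous_on differentiable_imp_continuous_within)
next
  case (Suc k)
  have "times_differentiable_on k U (\<lambda>x. frechet_derivative f (at x) v)" for v
    using Suc.IH[OF times_differentiable_on_SucD(2)[OF Suc.prems]] .
  then show ?case using Suc.prems by simp
qed

lemma times_differentiable_on_subset:
  "times_differentiable_on k U f \<Longrightarrow> V \<subseteq> U \<Longrightarrow> times_differentiable_on k V f"
  by (induction k arbitrary: f) (auto intro: continuous_on_subset)

lemma times_differentiable_on_const:
  assumes "open U"
  shows "times_differentiable_on k U (\<lambda>x. c)"
proof (induction k arbitrary: c)
  case (Suc k)
  show ?case by (rule times_differentiable_on_SucI[OF assms has_derivative_const Suc.IH])
qed simp

lemma times_differentiable_on_linear: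
  assumes "open U" "bounded_linear L"
  shows "times_differentiable_on k U L"
proof (cases k)
  case 0
  then show ?thesis using assms(2) by (simp add: linear_continuous_on)
next
  case (Suc n)
  show ?thesis unfolding Suc
    by (rule times_differentiable_on_SucI[OF assms(1), where D = "\<lambda>x. L"])
      (use assms bounded_linear_imp_has_derivative times_differentiable_on_const in auto)
qed

lemma times_differentiable_on_compose_linear:
  assumes "open U" "bounded_linear L" "times_differentiable_on k U f"
  shows "times_differentiable_on k U (\<lambda>x. L (f x))"
  using assms(3)
proof (induction k arbitrary: f)
  case 0
  then show ?case using bounded_linear.continuous_on[OF assms(2)] by simp
next
  case (Suc k)
  show ?case
    by (rule times_differentiable_on_SucI[OF assms(1)
          bounded_linear.has_derivative[OF assms(2) times_differentiable_on_SucD(1)[OF Suc.prems]]])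
      (use Suc times_differentiable_on_SucD(2) in blast)+
qed

lemma times_differentiable_on_add:
  assumes "open U" "times_differentiable_on k U f" "times_differentiable_on k U g"
  shows "times_differentiable_on k U (\<lambda>x. f x + g x)"
  using assms(2,3)
proof (induction k arbitrary: f g)
  case 0
  then show ?case by (simp add: continuous_on_add)
next
  case (Suc k)
  show ?case
    by (rule times_differentiable_on_SucI[OF assms(1)
          has_derivative_add[OF times_differentiable_on_SucD(1)[OF Suc.prems(1)]
            times_differentiable_on_SucD(1)[OF Suc.prems(2)]]])
      (use Suc times_differentiable_on_SucD(2) in blast)+
qed

text \<open>The product rule leaves one factor undifferentiated in each of its two terms;
  \<open>times_differentiable_on_pred\<close> lowers the order of that factor, and the induction
  hypothesis for arbitrary \<open>f\<close> and \<open>g\<close> applies.\<close>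

lemma times_differentiable_on_bilinear:
  assumes "open U" "bounded_bilinear B"
    and "times_differentiable_on k U f" "times_differentiable_on k U g"
  shows "times_differentiable_on k U (\<lambda>x. B (f x) (g x))"
  using assms(3,4)
proof (induction k arbitrary: f g)
  case 0
  then show ?case using bounded_bilinear.continuous_on[OF assms(2)] by simp
next
  case (Suc k)
  show ?case
    by (rule times_differentiable_on_SucI[OF assms(1)
          bounded_bilinear.FDERIV[OF assms(2) times_differentiable_on_SucD(1)[OF Suc.prems(1)]
            times_differentiable_on_SucD(1)[OF Suc.prems(2)]]])
      (assumption, assumption, intro times_differentiable_on_add[OF assms(1)] Suc.IH
        times_differentiable_on_pred[OF Suc.prems(1)] times_differentiable_on_pred[OF Suc.prems(2)]
        times_differentiable_on_SucD(2)[OF Suc.prems(1)]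
        times_differentiable_on_SucD(2)[OF Suc.prems(2)])
qed

text \<open>The derivative of the reciprocal contains the reciprocal again, but only to order
  \<open>k\<close>, where the induction hypothesis provides it.\<close>

lemma times_differentiable_on_inverse:
  fixes f :: "'a::real_normed_vector \<Rightarrow> real"
  assumes "open U" "times_differentiable_on k U f" "\<And>x. x \<in> U \<Longrightarrow> f x \<noteq> 0"
  shows "times_differentiable_on k U (\<lambda>x. inverse (f x))"
  using assms(2)
proof (induction k)
  case 0
  then show ?case using assms(3) by (auto intro: continuous_on_inverse)
next
  case (Suc k)
  note bil = times_differentiable_on_bilinear[OF assms(1) bounded_bilinear_mult]
  have inv: "times_differentiable_on k U (\<lambda>x. inverse (f x))"
    using Suc times_differentiable_on_pred by blast
  show ?case
    by (rule times_differentiable_on_SucI[OF assms(1)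
          Deriv.has_derivative_inverse[OF assms(3) times_differentiable_on_SucD(1)[OF Suc.prems]]])
      (assumption, assumption, intro times_differentiable_on_compose_linear[OF assms(1)
          bounded_linear_minus[OF bounded_linear_ident]]
        bil inv times_differentiable_on_SucD(2)[OF Suc.prems])
qed

section \<open>Closure properties of C-infinity maps on open sets\<close>

lemma smooth_on_subset: "smooth_on U f \<Longrightarrow> V \<subseteq> U \<Longrightarrow> smooth_on V f"
  unfolding smooth_on_def using times_differentiable_on_subset by blast

lemma smooth_on_has_derivative:
  "smooth_on U f \<Longrightarrow> x \<in> U \<Longrightarrow> (f has_derivative frechet_derivative f (at x)) (at x)"
  unfolding smooth_on_def using times_differentiable_on_SucD(1) by blast

lemma smooth_on_frechet_derivative:
  "smooth_on U f \<Longrightarrow> smooth_on U (\<lambda>x. frechet_derivative f (at x) v)"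
  unfolding smooth_on_def using times_differentiable_on_SucD(2) by blast

lemma smooth_on_continuous_on: "smooth_on U f \<Longrightarrow> continuous_on U f"
  unfolding smooth_on_def using times_differentiable_on.simps(1) by blast

lemma smooth_on_const: "open U \<Longrightarrow> smooth_on U (\<lambda>x. c)"
  by (simp add: smooth_on_def times_differentiable_on_const)

lemma smooth_on_linear: "open U \<Longrightarrow> bounded_linear L \<Longrightarrow> smooth_on U L"
  by (simp add: smooth_on_def times_differentiable_on_linear)

lemma smooth_on_compose_linear:
  "open U \<Longrightarrow> bounded_linear L \<Longrightarrow> smooth_on U f \<Longrightarrow> smooth_on U (\<lambda>x. L (f x))"
  by (simp add: smooth_on_def times_differentiable_on_compose_linear)

lemma smooth_on_add:
  "open U \<Longrightarrow> smooth_on U f \<Longrightarrow> smooth_on U g \<Longrightarrow> smooth_on U (\<lambda>x. f x + g x)"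
  by (simp add: smooth_on_def times_differentiable_on_add)

lemma smooth_on_bilinear:
  "open U \<Longrightarrow> bounded_bilinear B \<Longrightarrow> smooth_on U f \<Longrightarrow> smooth_on U g
    \<Longrightarrow> smooth_on U (\<lambda>x. B (f x) (g x))"
  by (simp add: smooth_on_def times_differentiable_on_bilinear)

lemma smooth_on_inverse:
  fixes f :: "'a::real_normed_vector \<Rightarrow> real"
  shows "open U \<Longrightarrow> smooth_on U f \<Longrightarrow> (\<And>x. x \<in> U \<Longrightarrow> f x \<noteq> 0) \<Longrightarrow> smooth_on U (\<lambda>x. inverse (f x))"
  by (simp add: smooth_on_def times_differentiable_on_inverse)

lemma smooth_on_Pair:
  assumes "open U" "smooth_on U f" "smooth_on U g"
  shows "smooth_on U (\<lambda>x. (f x, g x))"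
proof -
  have "smooth_on U (\<lambda>x. (f x, 0) + (0, g x))"
    by (intro smooth_on_add smooth_on_compose_linear[OF assms(1) _ assms(2)]
        smooth_on_compose_linear[OF assms(1) _ assms(3)] assms(1)
        bounded_linear_Pair bounded_linear_ident bounded_linear_zero)
  then show ?thesis by simp
qed

section \<open>Smooth maps on a submanifold\<close>

lemma smooth_mapI:
  assumes "open U" "M \<subseteq> U" "smooth_on U F" "\<And>x. x \<in> M \<Longrightarrow> F x = f x"
  shows "smooth_map M f"
  using assms unfolding smooth_map_def smooth_extension_of_def by blast

lemma smooth_mapE:
  assumes "smooth_map M f"
  obtains U F where "open U" "M \<subseteq> U" "smooth_on U F" "\<And>x. x \<in> M \<Longrightarrow> F x = f x"
  using assms unfolding smooth_map_def smooth_extension_of_def by blast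

lemma smooth_map_cong:
  "smooth_map M f \<Longrightarrow> (\<And>x. x \<in> M \<Longrightarrow> f x = g x) \<Longrightarrow> smooth_map M g"
  by (elim smooth_mapE) (auto intro: smooth_mapI)

named_theorems smooth_intros

lemma smooth_map_const [smooth_intros]: "smooth_map M (\<lambda>x. c)"
  by (rule smooth_mapI[of UNIV]) (auto intro: smooth_on_const)

lemma smooth_map_linear: "bounded_linear L \<Longrightarrow> smooth_map M L"
  by (rule smooth_mapI[of UNIV]) (auto intro: smooth_on_linear)

lemma smooth_map_id [smooth_intros]: "smooth_map M (\<lambda>x. x)"
  by (rule smooth_map_linear[OF bounded_linear_ident])

lemma smooth_map_compose_linear:
  assumes "bounded_linear L" "smooth_map M f"
  shows "smooth_map M (\<lambda>x. L (f x))"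
  using assms(2)
proof (rule smooth_mapE)
  fix U F assume "open U" "M \<subseteq> U" "smooth_on U F" "\<And>x. x \<in> M \<Longrightarrow> F x = f x"
  then show ?thesis
    using smooth_on_compose_linear[OF \<open>open U\<close> assms(1)] by (intro smooth_mapI[of U M "\<lambda>x. L (F x)"]) auto
qed

text \<open>The third assumption ranges over all open sets because the two extensions live on
  different neighbourhoods of \<open>M\<close> and are combined on the intersection.\<close>

lemma smooth_map_combine:
  fixes M :: "'a::euclidean_space set"
  assumes "smooth_map M f" "smooth_map M g"
    and "\<And>(U::'a set) F G. open U \<Longrightarrow> smooth_on U F \<Longrightarrow> smooth_on U G \<Longrightarrow> smooth_on U (\<lambda>x. B (F x) (G x))"
  shows "smooth_map M (\<lambda>x. B (f x) (g x))"
proof -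
  obtain U F where F: "open U" "M \<subseteq> U" "smooth_on U F" "\<And>x. x \<in> M \<Longrightarrow> F x = f x"
    using assms(1) by (rule smooth_mapE) blast
  obtain V G where G: "open V" "M \<subseteq> V" "smooth_on V G" "\<And>x. x \<in> M \<Longrightarrow> G x = g x"
    using assms(2) by (rule smooth_mapE) blast
  have "smooth_on (U \<inter> V) (\<lambda>x. B (F x) (G x))"
    using F G by (intro assms(3)) (auto intro: smooth_on_subset)
  then show ?thesis using F G by (intro smooth_mapI[of "U \<inter> V" M "\<lambda>x. B (F x) (G x)"]) auto
qed

lemma smooth_map_bilinear:
  assumes "bounded_bilinear B" "smooth_map M f" "smooth_map M g"
  shows "smooth_map M (\<lambda>x. B (f x) (g x))"
  using assms(2,3) by (rule smooth_map_combine[where B = B]) (rule smooth_on_bilinear[OF _ assms(1)])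

lemma smooth_map_add [smooth_intros]:
  "smooth_map M f \<Longrightarrow> smooth_map M g \<Longrightarrow> smooth_map M (\<lambda>x. f x + g x)"
  by (rule smooth_map_combine[where B = "(+)"]) (auto intro: smooth_on_add)

lemma smooth_map_Pair [smooth_intros]:
  "smooth_map M f \<Longrightarrow> smooth_map M g \<Longrightarrow> smooth_map M (\<lambda>x. (f x, g x))"
  by (rule smooth_map_combine[where B = Pair]) (auto intro: smooth_on_Pair)

lemma smooth_map_minus [smooth_intros]: "smooth_map M f \<Longrightarrow> smooth_map M (\<lambda>x. - f x)"
  by (rule smooth_map_compose_linear[OF bounded_linear_minus[OF bounded_linear_ident]])

lemma smooth_map_diff [smooth_intros]:
  "smooth_map M f \<Longrightarrow> smooth_map M g \<Longrightarrow> smooth_map M (\<lambda>x. f x - g x)"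
  using smooth_map_add[of M f "\<lambda>x. - g x"] smooth_map_minus[of M g] by simp

lemma bounded_bilinear_cross3: "bounded_bilinear cross3"
  using bilinear_conv_bounded_bilinear bilinear_cross by blast

lemmas [smooth_intros] =
  smooth_map_bilinear[OF bounded_bilinear_inner]
  smooth_map_bilinear[OF bounded_bilinear_mult]
  smooth_map_bilinear[OF bounded_bilinear_scaleR]
  smooth_map_bilinear[OF bounded_bilinear_cross3]
  smooth_map_compose_linear[OF bounded_linear_fst]
  smooth_map_compose_linear[OF bounded_linear_snd]
  smooth_map_compose_linear[OF bounded_linear_vec_nth]

lemma smooth_map_sum [smooth_intros]:
  "(\<And>i. i \<in> A \<Longrightarrow> smooth_map M (f i)) \<Longrightarrow> smooth_map M (\<lambda>x. \<Sum>i\<in>A. f i x)"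
  by (induction A rule: infinite_finite_induct) (auto intro: smooth_intros)

lemma smooth_map_inverse [smooth_intros]:
  fixes f :: "'a::euclidean_space \<Rightarrow> real"
  assumes "smooth_map M f" "\<And>x. x \<in> M \<Longrightarrow> f x \<noteq> 0"
  shows "smooth_map M (\<lambda>x. inverse (f x))"
proof -
  obtain U F where F: "open U" "M \<subseteq> U" "smooth_on U F" "\<And>x. x \<in> M \<Longrightarrow> F x = f x"
    using assms(1) by (rule smooth_mapE) blast
  \<comment> \<open>The extension is known to be nonzero only on \<open>M\<close>, so the
    neighbourhood is shrunk to the points where it does not vanish.\<close>
  define V where "V = U \<inter> F -` (- {0})"
  have "open V" unfolding V_def
    by (intro continuous_open_preimage smooth_on_continuous_on F) auto
  moreover have "M \<subseteq> V" using F assms(2) by (auto simp: V_def)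
  moreover have "smooth_on V (\<lambda>x. inverse (F x))"
    using \<open>open V\<close> F(3) by (intro smooth_on_inverse) (auto intro: smooth_on_subset simp: V_def)
  ultimately show ?thesis using F(4) by (intro smooth_mapI[of V M "\<lambda>x. inverse (F x)"]) auto
qed

lemma smooth_map_differentiable:
  assumes "smooth_map M f" "p \<in> M"
  shows "f differentiable (at p within M)"
proof -
  obtain U F where F: "open U" "M \<subseteq> U" "smooth_on U F" "\<And>x. x \<in> M \<Longrightarrow> F x = f x"
    using assms(1) by (rule smooth_mapE) blast
  have "(F has_derivative frechet_derivative F (at p)) (at p within M)"
    using smooth_on_has_derivative[OF F(3)] F(2) assms(2) has_derivative_at_withinI by blast
  then have "(f has_derivative frechet_derivative F (at p)) (at p within M)"
    by (rule has_derivative_transform[rotated 2]) (use F assms in auto)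
  then show ?thesis by (auto simp: differentiable_def)
qed

section \<open>Derivatives along the submanifold\<close>

lemma deriv_along_has_derivative:
  "smooth_map M f \<Longrightarrow> p \<in> M \<Longrightarrow> (f has_derivative (\<lambda>v. deriv_along M p v f)) (at p within M)"
  unfolding deriv_along_def
  using smooth_map_differentiable frechet_derivative_works by blast

text \<open>Along a curve in \<open>M\<close> with velocity \<open>v\<close>, the chain rule turns
  either derivative into the ordinary derivative of \<open>f \<circ> c\<close> at 0, and that one is
  unique.\<close>

lemma has_derivative_along_tangent_unique:
  assumes "(f has_derivative D) (at p within M)" "(f has_derivative D') (at p within M)"
    and "v \<in> tangent_space M p"
  shows "D v = D' v"
proof -
  obtain c e where c: "0 < e" "c ` {-e<..<e} \<subseteq> M" "c 0 = p" "(c has_vector_derivative v) (at 0)"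
    using assms(3) unfolding tangent_space_def by blast
  have *: "((f \<circ> c) has_vector_derivative A v) (at 0 within {-e<..<e})"
    if "(f has_derivative A) (at p within M)" for A
  proof -
    have "(f has_derivative A) (at (c 0) within c ` {-e<..<e})"
      using that c(2,3) has_derivative_subset by blast
    then show ?thesis
      by (rule vector_derivative_diff_chain_within[OF has_vector_derivative_at_within[OF c(4)]])
  qed
  have "at (0::real) within {-e<..<e} = at 0" using c(1) by (intro at_within_open) auto
  then show ?thesis
    using vector_derivative_unique_at[of "f \<circ> c" "D v" 0 "D' v"] *[OF assms(1)] *[OF assms(2)]
    by simp
qed

lemma deriv_along_eqI:
  assumes "(f has_derivative D) (at p within M)" "v \<in> tangent_space M p"
  shows "deriv_along M p v f = D v"
proof -
  have "(f has_derivative frechet_derivative f (at p within M)) (at p within M)"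
    using assms(1) frechet_derivative_works by (auto simp: differentiable_def)
  then show ?thesis
    unfolding deriv_along_def by (rule has_derivative_along_tangent_unique[OF _ assms])
qed

text \<open>Within \<open>M\<close> both functions have exactly the same derivatives, so the choice
  hidden in \<open>frechet_derivative\<close> is literally the same, whatever the direction
  \<open>v\<close>.\<close>

lemma deriv_along_cong:
  assumes "p \<in> M" "\<And>x. x \<in> M \<Longrightarrow> f x = g x"
  shows "deriv_along M p v f = deriv_along M p v g"
proof -
  have "(f has_derivative D) (at p within M) \<longleftrightarrow> (g has_derivative D) (at p within M)" for D
    using assms has_derivative_transform[of p M f g D] has_derivative_transform[of p M g f D]
    by auto
  then show ?thesis by (simp add: deriv_along_def frechet_derivative_def)
qed

lemma deriv_along_extension:
  assumes "open U" "M \<subseteq> U" "smooth_on U F" "\<And>x. x \<in> M \<Longrightarrow> F x = f x"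
    and "p \<in> M" "v \<in> tangent_space M p"
  shows "deriv_along M p v f = frechet_derivative F (at p) v"
proof -
  have "(F has_derivative frechet_derivative F (at p)) (at p within M)"
    using smooth_on_has_derivative[OF assms(3)] assms(2,5) has_derivative_at_withinI by blast
  then show ?thesis
    using deriv_along_cong[where f = F and g = f and v = v, OF assms(5,4)] deriv_along_eqI[OF _ assms(6)]
    by fastforce
qed

text \<open>Smoothness of derivatives is available for constant directions only; expanding
  \<open>X p\<close> in the standard basis moves the dependence on \<open>p\<close> into smooth
  coefficients.\<close>

lemma smooth_map_deriv_along:
  fixes f :: "'a::euclidean_space \<Rightarrow> 'b::real_normed_vector"
  assumes "smooth_map M f" "smooth_map M X" "\<And>p. p \<in> M \<Longrightarrow> X p \<in> tangent_space M p"
  shows "smooth_map M (\<lambda>p. deriv_along M p (X p) f)"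
proof -
  obtain U F where F: "open U" "M \<subseteq> U" "smooth_on U F" "\<And>x. x \<in> M \<Longrightarrow> F x = f x"
    using assms(1) by (rule smooth_mapE) blast
  have "smooth_map M (\<lambda>p. frechet_derivative F (at p) i)" for i
    by (rule smooth_mapI[OF F(1,2) smooth_on_frechet_derivative[OF F(3)]]) simp
  then have "smooth_map M (\<lambda>p. \<Sum>i\<in>Basis. (X p \<bullet> i) *\<^sub>R frechet_derivative F (at p) i)"
    by (intro smooth_intros assms)
  then show ?thesis
  proof (rule smooth_map_cong)
    fix p assume p: "p \<in> M"
    have lin: "linear (frechet_derivative F (at p))"
      using smooth_on_has_derivative[OF F(3)] F(2) p has_derivative_linear by blast
    have "deriv_along M p (X p) f = frechet_derivative F (at p) (X p)"
      using deriv_along_extension[OF F p] assms(3) p by blast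
    also have "\<dots> = frechet_derivative F (at p) (\<Sum>i\<in>Basis. (X p \<bullet> i) *\<^sub>R i)"
      by (simp add: euclidean_representation)
    also have "\<dots> = (\<Sum>i\<in>Basis. (X p \<bullet> i) *\<^sub>R frechet_derivative F (at p) i)"
      by (simp add: linear_sum[OF lin] linear_cmul[OF lin])
    finally show "(\<Sum>i\<in>Basis. (X p \<bullet> i) *\<^sub>R frechet_derivative F (at p) i) = deriv_along M p (X p) f"
      by simp
  qed
qed

lemma deriv_along_linear:
  assumes "smooth_map M f" "p \<in> M"
  shows "linear (\<lambda>v. deriv_along M p v f)"
  using deriv_along_has_derivative[OF assms] has_derivative_linear by blast

lemma deriv_along_const: "v \<in> tangent_space M p \<Longrightarrow> deriv_along M p v (\<lambda>x. c) = 0"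
  by (rule deriv_along_eqI[OF has_derivative_const])

lemma deriv_along_id: "v \<in> tangent_space M p \<Longrightarrow> deriv_along M p v (\<lambda>x. x) = v"
  by (rule deriv_along_eqI[OF has_derivative_ident])

lemma deriv_along_compose_linear:
  assumes "bounded_linear L" "smooth_map M f" "p \<in> M" "v \<in> tangent_space M p"
  shows "deriv_along M p v (\<lambda>x. L (f x)) = L (deriv_along M p v f)"
  using assms(4)
  by (rule deriv_along_eqI[OF bounded_linear.has_derivative[OF assms(1)
          deriv_along_has_derivative[OF assms(2,3)]]])

lemma deriv_along_bilinear:
  assumes "bounded_bilinear B" "smooth_map M f" "smooth_map M g" "p \<in> M" "v \<in> tangent_space M p"
  shows "deriv_along M p v (\<lambda>x. B (f x) (g x))
    = B (f p) (deriv_along M p v g) + B (deriv_along M p v f) (g p)"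
  using assms(5)
  by (rule deriv_along_eqI[OF bounded_bilinear.FDERIV[OF assms(1)
          deriv_along_has_derivative[OF assms(2,4)] deriv_along_has_derivative[OF assms(3,4)]]])

lemma deriv_along_add:
  assumes "smooth_map M f" "smooth_map M g" "p \<in> M" "v \<in> tangent_space M p"
  shows "deriv_along M p v (\<lambda>x. f x + g x) = deriv_along M p v f + deriv_along M p v g"
  using assms(4)
  by (rule deriv_along_eqI[OF has_derivative_add[OF
          deriv_along_has_derivative[OF assms(1,3)] deriv_along_has_derivative[OF assms(2,3)]]])

lemma deriv_along_diff:
  assumes "smooth_map M f" "smooth_map M g" "p \<in> M" "v \<in> tangent_space M p"
  shows "deriv_along M p v (\<lambda>x. f x - g x) = deriv_along M p v f - deriv_along M p v g"
  using assms(4)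
  by (rule deriv_along_eqI[OF has_derivative_diff[OF
          deriv_along_has_derivative[OF assms(1,3)] deriv_along_has_derivative[OF assms(2,3)]]])

lemma deriv_along_Pair:
  assumes "smooth_map M f" "smooth_map M g" "p \<in> M" "v \<in> tangent_space M p"
  shows "deriv_along M p v (\<lambda>x. (f x, g x)) = (deriv_along M p v f, deriv_along M p v g)"
  using assms(4)
  by (rule deriv_along_eqI[OF has_derivative_Pair[OF
          deriv_along_has_derivative[OF assms(1,3)] deriv_along_has_derivative[OF assms(2,3)]]])

lemma deriv_along_minus:
  assumes "smooth_map M f" "p \<in> M" "v \<in> tangent_space M p"
  shows "deriv_along M p v (\<lambda>x. - f x) = - deriv_along M p v f"
  by (rule deriv_along_compose_linear[OF bounded_linear_minus[OF bounded_linear_ident] assms])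

lemmas deriv_along_fst = deriv_along_compose_linear[OF bounded_linear_fst]
  and deriv_along_snd = deriv_along_compose_linear[OF bounded_linear_snd]
  and deriv_along_inner = deriv_along_bilinear[OF bounded_bilinear_inner]
  and deriv_along_mult = deriv_along_bilinear[OF bounded_bilinear_mult]
  and deriv_along_scaleR = deriv_along_bilinear[OF bounded_bilinear_scaleR]
  and deriv_along_cross3 = deriv_along_bilinear[OF bounded_bilinear_cross3]

lemmas deriv_along_simps = deriv_along_const deriv_along_id deriv_along_fst deriv_along_snd
  deriv_along_inner deriv_along_mult deriv_along_scaleR deriv_along_cross3
  deriv_along_add deriv_along_diff deriv_along_minus

lemma vector_field_smooth: "vector_field M X \<Longrightarrow> smooth_map M X"
  and vector_field_tangent: "vector_field M X \<Longrightarrow> p \<in> M \<Longrightarrow> X p \<in> tangent_space M p"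
  by (auto simp: vector_field_def)

lemma smooth_map_lie_bracket:
  "vector_field M X \<Longrightarrow> vector_field M Y \<Longrightarrow> smooth_map M (lie_bracket M X Y)"
  unfolding lie_bracket_def
  by (intro smooth_map_diff smooth_map_deriv_along) (auto simp: vector_field_def)

section \<open>The phase space\<close>

lemma fst_inner_phase_space: "p \<in> phase_space \<longleftrightarrow> fst p \<bullet> fst p = 1"
  by (simp add: phase_space_def norm_eq_1)

lemma tangent_phase_space_orthogonal:
  assumes "p \<in> phase_space" "v \<in> tangent_space phase_space p"
  shows "fst p \<bullet> fst v = 0"
proof -
  have "deriv_along phase_space p v (\<lambda>x. fst x \<bullet> fst x) = deriv_along phase_space p v (\<lambda>x. 1)"
    using assms(1) by (intro deriv_along_cong) (auto simp: fst_inner_phase_space)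
  then have "2 * (fst p \<bullet> fst v) = 0"
    using assms by (simp add: deriv_along_simps smooth_intros inner_commute)
  then show ?thesis by simp
qed

text \<open>The witness curve is chosen rational so that its smoothness follows from the closure
  rules for products and inverses alone.\<close>

lemma orthogonal_tangent_phase_space:
  assumes p: "p \<in> phase_space" and v: "fst p \<bullet> fst v = 0"
  shows "v \<in> tangent_space phase_space p"
proof -
  \<comment> \<open>the rational parametrization of the great circle through \<open>fst p\<close> in the direction \<open>fst v\<close>\<close>
  define a where "a = (fst v \<bullet> fst v) / 4"
  define d where "d t = inverse (1 + a * (t * t))" for t :: real
  define c where "c t = (d t *\<^sub>R ((1 - a * (t * t)) *\<^sub>R fst p + t *\<^sub>R fst v), snd p + t *\<^sub>R snd v)" for t
  have pos: "1 + a * (t * t) > 0" for t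
    by (simp add: a_def add_pos_nonneg)
  have "smooth_map UNIV (\<lambda>t. 1 + a * (t * t))" by (intro smooth_intros)
  then have "smooth_map UNIV d"
    unfolding d_def by (rule smooth_map_inverse) (use pos in \<open>simp add: less_imp_neq[symmetric]\<close>)
  then have "smooth_map UNIV c"
    unfolding c_def by (intro smooth_intros)
  then have c_smooth: "smooth_on UNIV c"
    by (rule smooth_mapE) (metis UNIV_I ext top.extremum_uniqueI)
  have "c t \<in> phase_space" for t
  proof -
    have "fst (c t) \<bullet> fst (c t) = d t * d t * ((1 - a * (t * t)) * (1 - a * (t * t)) * (fst p \<bullet> fst p)
        + 2 * (1 - a * (t * t)) * t * (fst p \<bullet> fst v) + t * t * (fst v \<bullet> fst v))"
      by (simp add: c_def inner_add inner_commute algebra_simps)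
    \<comment> \<open>The value of \<open>a\<close> is the one that makes (1 - a t^2)^2 + t^2 |fst
      v|^2 the square of 1 + a t^2.\<close>
    also have "\<dots> = d t * d t * ((1 + a * (t * t)) * (1 + a * (t * t)))"
      using p v by (simp add: fst_inner_phase_space a_def algebra_simps)
    also have "\<dots> = (d t * (1 + a * (t * t))) * (d t * (1 + a * (t * t)))"
      by (simp only: mult_ac)
    also have "\<dots> = 1" using pos[of t] by (simp add: d_def)
    finally show ?thesis by (simp add: fst_inner_phase_space)
  qed
  moreover have "(c has_vector_derivative v) (at 0)"
  proof -
    have "(d has_real_derivative 0) (at 0)"
      unfolding d_def by (auto intro!: derivative_eq_intros)
    then have "(d has_vector_derivative 0) (at 0)"
      by (simp add: has_real_derivative_iff_has_vector_derivative)
    moreover have "((\<lambda>t. (1 - a * (t * t)) *\<^sub>R fst p + t *\<^sub>R fst v) has_vector_derivative fst v) (at 0)"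
      by (auto intro!: derivative_eq_intros has_vector_derivative_scaleR
          has_vector_derivative_add[where f' = 0, simplified])
    ultimately have "((\<lambda>t. d t *\<^sub>R ((1 - a * (t * t)) *\<^sub>R fst p + t *\<^sub>R fst v))
        has_vector_derivative fst v) (at 0)"
      using bounded_bilinear.has_vector_derivative[OF bounded_bilinear_scaleR] by (fastforce simp: d_def)
    moreover have "((\<lambda>t. snd p + t *\<^sub>R snd v) has_vector_derivative snd v) (at 0)"
      by (auto intro!: derivative_eq_intros)
    ultimately show ?thesis
      using has_vector_derivative_Pair unfolding c_def by fastforce
  qed
  ultimately show ?thesis
    unfolding tangent_space_def using smooth_on_subset[OF c_smooth]
    by (intro CollectI exI[of _ c] exI[of _ 1]) (auto simp: c_def d_def)
qed

lemma tangent_phase_space: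
  "p \<in> phase_space \<Longrightarrow> v \<in> tangent_space phase_space p \<longleftrightarrow> fst p \<bullet> fst v = 0"
  using tangent_phase_space_orthogonal orthogonal_tangent_phase_space by blast

text \<open>On the phase space this is the orthogonal projection onto the tangent space. For fixed
  \<open>v\<close> it is a global smooth vector field, hence a witness for the choice in
  \<open>field_through\<close>; applied to basis vectors it also gives covectors ambient
  coordinates.\<close>

definition tangent_proj :: "phase \<Rightarrow> phase \<Rightarrow> phase" where
  "tangent_proj p v = (fst v - (fst p \<bullet> fst v) *\<^sub>R fst p, snd v)"

lemma tangent_proj_tangent:
  "p \<in> phase_space \<Longrightarrow> tangent_proj p v \<in> tangent_space phase_space p"
  by (simp add: tangent_phase_space tangent_proj_def inner_diff_right fst_inner_phase_space)

lemma tangent_proj_ident: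
  "p \<in> phase_space \<Longrightarrow> v \<in> tangent_space phase_space p \<Longrightarrow> tangent_proj p v = v"
  by (simp add: tangent_phase_space tangent_proj_def)

lemma linear_tangent_proj: "linear (tangent_proj p)"
  by (rule linearI) (auto simp: tangent_proj_def inner_add_right scaleR_left_distrib algebra_simps)

lemma vector_field_tangent_proj: "vector_field phase_space (\<lambda>p. tangent_proj p v)"
  unfolding vector_field_def
  by (auto simp: tangent_proj_tangent) (auto simp: tangent_proj_def intro!: smooth_intros)

lemma field_through:
  assumes "p \<in> phase_space" "v \<in> tangent_space phase_space p"
  shows "vector_field phase_space (field_through phase_space p v)"
    and "field_through phase_space p v p = v"
proof -
  have "\<exists>Z. vector_field phase_space Z \<and> Z p = v"
    using vector_field_tangent_proj tangent_proj_ident[OF assms] by blast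
  then show "vector_field phase_space (field_through phase_space p v)"
    and "field_through phase_space p v p = v"
    unfolding field_through_def by (metis (mono_tags, lifting) someI_ex)+
qed

text \<open>Differentiating the tangency condition of \<open>Z\<close> along \<open>W\<close> leaves
  \<open>fst (W p) \<bullet> fst (Z p)\<close> as the defect from tangency. It is symmetric in the
  two fields, so it cancels in the bracket.\<close>

lemma vector_field_lie_bracket:
  assumes X: "vector_field phase_space X" and Y: "vector_field phase_space Y"
  shows "vector_field phase_space (lie_bracket phase_space X Y)"
proof -
  have *: "fst (W p) \<bullet> fst (Z p) + fst p \<bullet> fst (deriv_along phase_space p (W p) Z) = 0"
    if "p \<in> phase_space" and W: "vector_field phase_space W" and Z: "vector_field phase_space Z" for p W Z
  proof -
    have t: "W p \<in> tangent_space phase_space p" using vector_field_tangent that by blast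
    have "deriv_along phase_space p (W p) (\<lambda>x. fst x \<bullet> fst (Z x)) = deriv_along phase_space p (W p) (\<lambda>x. 0)"
      using that(1) vector_field_tangent[OF Z] tangent_phase_space by (intro deriv_along_cong) auto
    then show ?thesis
      using that(1) t vector_field_smooth[OF Z] by (simp add: deriv_along_simps smooth_intros)
  qed
  show ?thesis
    unfolding vector_field_def
  proof (intro conjI ballI)
    fix p assume p: "p \<in> phase_space"
    show "lie_bracket phase_space X Y p \<in> tangent_space phase_space p"
      using *[OF p X Y] *[OF p Y X] p
      by (simp add: tangent_phase_space lie_bracket_def inner_diff_right inner_commute)
  qed (rule smooth_map_lie_bracket[OF X Y])
qed

section \<open>Covectors represented by ambient vectors\<close>

definition covector_rep :: "phase \<Rightarrow> (phase \<Rightarrow> real) \<Rightarrow> phase" where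
  "covector_rep p a = (\<Sum>i\<in>Basis. a (tangent_proj p i) *\<^sub>R i)"

lemma covector_rep_inner:
  assumes p: "p \<in> phase_space" and a: "a \<in> cotangent_space phase_space p"
    and v: "v \<in> tangent_space phase_space p"
  shows "a v = covector_rep p a \<bullet> v"
proof -
  let ?T = "tangent_space phase_space p"
  have add: "a (u + w) = a u + a w" if "u \<in> ?T" "w \<in> ?T" for u w
    using a that by (auto simp: cotangent_space_def)
  have scale: "a (c *\<^sub>R u) = c * a u" if "u \<in> ?T" for c u
    using a that by (auto simp: cotangent_space_def)
  have closed: "c *\<^sub>R u \<in> ?T" "u + w \<in> ?T" "0 \<in> ?T" if "u \<in> ?T" "w \<in> ?T" for c u w
    using that p by (auto simp: tangent_phase_space inner_add_right)
  have t: "tangent_proj p i \<in> ?T" for i by (rule tangent_proj_tangent[OF p])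
  \<comment> \<open>The covector is linear on the tangent space only, so the induction over sums has
    to carry along that partial sums stay tangent.\<close>
  have "(\<Sum>i\<in>A. c i *\<^sub>R tangent_proj p i) \<in> ?T \<and>
        a (\<Sum>i\<in>A. c i *\<^sub>R tangent_proj p i) = (\<Sum>i\<in>A. c i * a (tangent_proj p i))"
    if "finite A" for A c
    using that
  proof (induction A)
    case empty
    show ?case using closed(3)[OF v v] scale[OF v, of 0] by simp
  next
    case (insert i A)
    then show ?case using closed[OF t t] add scale t closed by auto
  qed
  from this[of Basis "\<lambda>i. v \<bullet> i"]
  have "a (\<Sum>i\<in>Basis. (v \<bullet> i) *\<^sub>R tangent_proj p i) = (\<Sum>i\<in>Basis. (v \<bullet> i) * a (tangent_proj p i))"
    by simp
  moreover have "(\<Sum>i\<in>Basis. (v \<bullet> i) *\<^sub>R tangent_proj p i) = tangent_proj p (\<Sum>i\<in>Basis. (v \<bullet> i) *\<^sub>R i)"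
    by (simp add: linear_sum[OF linear_tangent_proj] linear_cmul[OF linear_tangent_proj])
  moreover have "tangent_proj p (\<Sum>i\<in>Basis. (v \<bullet> i) *\<^sub>R i) = v"
    by (simp add: euclidean_representation tangent_proj_ident[OF p v])
  ultimately show ?thesis
    by (simp add: covector_rep_def inner_sum_left inner_sum_right inner_commute mult.commute)
qed

lemma smooth_map_covector_rep:
  "one_form phase_space \<alpha> \<Longrightarrow> smooth_map phase_space (\<lambda>p. covector_rep p (\<alpha> p))"
  unfolding covector_rep_def one_form_def
  by (intro smooth_intros) (use vector_field_tangent_proj in blast)

section \<open>One-forms given by ambient vectors, and their Lie and exterior derivatives\<close>

lemma restrict_inner_cotangent:
  assumes "p \<in> phase_space"
  shows "(\<lambda>v\<in>tangent_space phase_space p. e \<bullet> v) \<in> cotangent_space phase_space p"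
  using assms by (auto simp: cotangent_space_def tangent_phase_space inner_add_right)

lemma one_form_restrict_inner:
  assumes "smooth_map phase_space e"
  shows "one_form phase_space (\<lambda>p. \<lambda>v\<in>tangent_space phase_space p. e p \<bullet> v)"
  unfolding one_form_def
proof (intro conjI ballI allI impI)
  fix X assume X: "vector_field phase_space X"
  have "smooth_map phase_space (\<lambda>p. e p \<bullet> X p)"
    by (intro smooth_intros assms vector_field_smooth[OF X])
  then show "smooth_map phase_space (\<lambda>p. (\<lambda>v\<in>tangent_space phase_space p. e p \<bullet> v) (X p))"
    by (rule smooth_map_cong) (simp add: vector_field_tangent[OF X])
qed (rule restrict_inner_cotangent)

lemma one_form_cong:
  assumes "one_form M \<alpha>" "\<And>p. p \<in> M \<Longrightarrow> \<alpha> p = \<beta> p"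
  shows "one_form M \<beta>"
  unfolding one_form_def
proof (intro conjI ballI allI impI)
  show "\<beta> p \<in> cotangent_space M p" if "p \<in> M" for p
    using assms that by (auto simp: one_form_def)
  fix X assume "vector_field M X"
  then have "smooth_map M (\<lambda>p. \<alpha> p (X p))" using assms(1) by (auto simp: one_form_def)
  then show "smooth_map M (\<lambda>p. \<beta> p (X p))"
    by (rule smooth_map_cong) (simp add: assms(2))
qed

text \<open>The derivative of the chosen extension \<open>Z\<close> of \<open>v\<close> occurs once
  in the product rule and once in the Lie bracket, and cancels: only \<open>v\<close> itself
  survives. The same cancellation, for both extensions, gives
  \<open>ext_deriv1_inner\<close>.\<close>

lemma lie_deriv1_inner:
  assumes p: "p \<in> phase_space" and v: "v \<in> tangent_space phase_space p"
    and X: "vector_field phase_space X" and b: "smooth_map phase_space b"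
    and \<beta>: "\<And>x u. x \<in> phase_space \<Longrightarrow> u \<in> tangent_space phase_space x \<Longrightarrow> \<beta> x u = b x \<bullet> u"
  shows "lie_deriv1 phase_space X \<beta> p v
    = deriv_along phase_space p (X p) b \<bullet> v + b p \<bullet> deriv_along phase_space p v X"
proof -
  define Z where "Z = field_through phase_space p v"
  have Z: "vector_field phase_space Z" "Z p = v" using field_through[OF p v] by (auto simp: Z_def)
  have Xp: "X p \<in> tangent_space phase_space p" by (rule vector_field_tangent[OF X p])
  have "deriv_along phase_space p (X p) (\<lambda>x. \<beta> x (Z x)) = deriv_along phase_space p (X p) (\<lambda>x. b x \<bullet> Z x)"
    by (intro deriv_along_cong p \<beta> vector_field_tangent[OF Z(1)])
  also have "\<dots> = b p \<bullet> deriv_along phase_space p (X p) Z + deriv_along phase_space p (X p) b \<bullet> v"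
    using deriv_along_inner[OF b vector_field_smooth[OF Z(1)] p Xp] Z(2) by simp
  moreover have "\<beta> p (lie_bracket phase_space X Z p) = b p \<bullet> lie_bracket phase_space X Z p"
    by (intro \<beta> p vector_field_tangent[OF vector_field_lie_bracket[OF X Z(1)]])
  ultimately show ?thesis
    unfolding lie_deriv1_def Let_def Z_def[symmetric]
    by (simp add: lie_bracket_def Z(2) inner_diff_right)
qed

lemma ext_deriv1_inner:
  assumes p: "p \<in> phase_space" and u: "u \<in> tangent_space phase_space p"
    and v: "v \<in> tangent_space phase_space p" and a: "smooth_map phase_space a"
    and \<alpha>: "\<And>x u. x \<in> phase_space \<Longrightarrow> u \<in> tangent_space phase_space x \<Longrightarrow> \<alpha> x u = a x \<bullet> u"
  shows "ext_deriv1 phase_space \<alpha> p u v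
    = deriv_along phase_space p u a \<bullet> v - deriv_along phase_space p v a \<bullet> u"
proof -
  define X where "X = field_through phase_space p u"
  define Y where "Y = field_through phase_space p v"
  have X: "vector_field phase_space X" "X p = u" using field_through[OF p u] by (auto simp: X_def)
  have Y: "vector_field phase_space Y" "Y p = v" using field_through[OF p v] by (auto simp: Y_def)
  have deriv: "deriv_along phase_space p w (\<lambda>x. \<alpha> x (Z x))
      = a p \<bullet> deriv_along phase_space p w Z + deriv_along phase_space p w a \<bullet> Z p"
    if Z: "vector_field phase_space Z" and w: "w \<in> tangent_space phase_space p" for Z w
  proof -
    have "deriv_along phase_space p w (\<lambda>x. \<alpha> x (Z x)) = deriv_along phase_space p w (\<lambda>x. a x \<bullet> Z x)"
      by (intro deriv_along_cong p \<alpha> vector_field_tangent[OF Z])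
    then show ?thesis
      using deriv_along_inner[OF a vector_field_smooth[OF Z] p w] by simp
  qed
  have "\<alpha> p (lie_bracket phase_space X Y p) = a p \<bullet> lie_bracket phase_space X Y p"
    by (intro \<alpha> p vector_field_tangent[OF vector_field_lie_bracket[OF X(1) Y(1)]])
  then show ?thesis
    unfolding ext_deriv1_def Let_def X_def[symmetric] Y_def[symmetric]
    by (simp add: deriv[OF X(1) v] deriv[OF Y(1) u] lie_bracket_def X(2) Y(2) inner_diff_right)
qed

section \<open>Identities for the cross product\<close>

text \<open>This is the contraction of \<open>l\<close> with the four-fold wedge product of
  \<open>g\<close>, \<open>u\<close>, \<open>v\<close>, \<open>w\<close>, which vanishes in
  dimension three.\<close>

lemma cross3_triple_expand:
  fixes g l u v w :: "real^3"
  shows "(l \<bullet> u) * (g \<bullet> cross3 v w) - (l \<bullet> v) * (g \<bullet> cross3 u w) + (l \<bullet> w) * (g \<bullet> cross3 u v)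
    = (l \<bullet> g) * (u \<bullet> cross3 v w)"
  by (simp add: cross3_simps)

lemma triple_product_tangent:
  fixes g u v w :: "real^3"
  assumes "g \<bullet> g = 1" "g \<bullet> u = 0" "g \<bullet> v = 0" "g \<bullet> w = 0"
  shows "u \<bullet> cross3 v w = 0"
  using cross3_triple_expand[of g u g v w] assms by simp

text \<open>Every functional \<open>f\<close> is an inner product, so
  \<open>cross3_triple_expand\<close> reduces the sum to a multiple of the determinant of three
  vectors in one plane. It serves twice: to remove the derivative of \<open>spin_coeff\<close> from
  dB, and to prove dB closed.\<close>

lemma alternating_sum_tangent:
  fixes g u v w :: "real^3" and f :: "real^3 \<Rightarrow> real"
  assumes "linear f" "g \<bullet> g = 1" "g \<bullet> u = 0" "g \<bullet> v = 0" "g \<bullet> w = 0"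
  shows "f u * (g \<bullet> cross3 v w) - f v * (g \<bullet> cross3 u w) + f w * (g \<bullet> cross3 u v) = 0"
proof -
  have "f x = adjoint f 1 \<bullet> x" for x
    using adjoint_works[OF assms(1), of x 1] by (simp add: inner_commute)
  then show ?thesis
    using cross3_triple_expand[of "adjoint f 1" u g v w] triple_product_tangent[OF assms(2-5)] by simp
qed

lemma cross3_Jacobi:
  fixes a b x :: "real^3"
  shows "cross3 b (cross3 a x) = cross3 (cross3 b a) x + cross3 a (cross3 b x)"
  by (simp add: cross3_simps)

text \<open>For \<open>x\<close> orthogonal to the unit vector \<open>g\<close>,
  \<open>cross3 (cross3 g x) g\<close> is \<open>x\<close>; here \<open>x\<close> is
  \<open>cross3 b g\<close>. This matches the derivatives of \<open>spin\<close> along Hamiltonian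
  fields in the Lie bracket with those in \<open>bracket_covector\<close>.\<close>

lemma cross3_sandwich:
  fixes b g :: "real^3"
  assumes "g \<bullet> g = 1"
  shows "cross3 (cross3 g (cross3 b g)) g = cross3 b g"
proof -
  have "cross3 (cross3 g (cross3 b g)) g = (g \<bullet> g) *\<^sub>R cross3 b g"
    by (simp add: cross3_simps)
  then show ?thesis using assms by simp
qed

text \<open>The map \<open>\<lambda>x. cross3 x g\<close> projects onto the plane orthogonal to
  \<open>g\<close> and turns it by a right angle, which preserves signed area. It evaluates the area
  form on two Hamiltonian vectors.\<close>

lemma cross3_triple_unit:
  fixes a b g :: "real^3"
  assumes "g \<bullet> g = 1"
  shows "g \<bullet> cross3 (cross3 a g) (cross3 b g) = g \<bullet> cross3 a b"
proof -
  have "g \<bullet> cross3 (cross3 a g) (cross3 b g) = (g \<bullet> g) * (g \<bullet> cross3 a b)"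
    by (simp add: cross3_simps)
  then show ?thesis using assms by simp
qed

lemmas cross3_distribs = cross_add_left cross_add_right Cross3.left_diff_distrib
  Cross3.right_diff_distrib cross_mult_left cross_mult_right

section \<open>The two-form and its exterior derivative\<close>

locale rank2_ball =
  fixes m r :: real and I :: "real^3"
  assumes m_pos: "0 < m" and r_pos: "0 < r" and I_pos: "\<And>i. 0 < I $ i"
begin

definition spin :: "phase \<Rightarrow> real" where
  "spin p = m * r\<^sup>2 * (angular_velocity m r I p \<bullet> fst p)"

definition inertia :: "3 \<Rightarrow> real" where
  "inertia i = I $ i + m * r\<^sup>2"

text \<open>
  Solving the linear system for \<open>\<Omega>\<close> gives \<open>m r\<^sup>2 (\<Omega> \<bullet> \<gamma>) = spin_coeff \<gamma> \<bullet> K\<close> on the phase space.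
\<close>

definition spin_denom :: "real^3 \<Rightarrow> real" where
  "spin_denom g = g \<bullet> (\<chi> i. I $ i / inertia i * g $ i)"

definition spin_coeff :: "real^3 \<Rightarrow> real^3" where
  "spin_coeff g = inverse (spin_denom g) *\<^sub>R (\<chi> i. m * r\<^sup>2 / inertia i * g $ i)"

lemma inertia_pos: "0 < inertia i"
  unfolding inertia_def using m_pos r_pos I_pos[of i] by (simp add: add_pos_pos)

text \<open>A sum of squares with the positive weights \<open>I $ i / inertia i\<close>. In this
  homogeneous form the denominator is positive at every nonzero vector, not just at unit
  ones.\<close>

lemma spin_denom_pos: "g \<noteq> 0 \<Longrightarrow> 0 < spin_denom g"
proof -
  assume "g \<noteq> 0"
  then obtain i where i: "g $ i \<noteq> 0" by (auto simp: vec_eq_iff)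
  have "0 < I $ j / inertia j" for j
    using I_pos[of j] inertia_pos[of j] by simp
  moreover have "0 < g $ i * g $ i" using i by (metis not_real_square_gt_zero)
  ultimately have "0 \<le> I $ j / inertia j * (g $ j * g $ j)" and "0 < I $ i / inertia i * (g $ i * g $ i)" for j
    by (metis less_imp_le mult_nonneg_nonneg zero_le_square, metis mult_pos_pos)
  then have "0 < (\<Sum>j\<in>UNIV. I $ j / inertia j * (g $ j * g $ j))"
    by (intro sum_pos2[of UNIV i]) auto
  then show ?thesis
    by (simp add: spin_denom_def inner_vec_def mult_ac)
qed

lemma bounded_linear_diagonal: "bounded_linear (\<lambda>g :: real^3. \<chi> i. d i * g $ i)"
  by (intro linear_conv_bounded_linear[THEN iffD1] linearI) (auto simp: vec_eq_iff algebra_simps)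

lemma smooth_map_spin_coeff:
  assumes "0 \<notin> M"
  shows "smooth_map M spin_coeff"
  unfolding spin_coeff_def
proof (intro smooth_intros smooth_map_linear[OF bounded_linear_diagonal])
  show "smooth_map M spin_denom"
    unfolding spin_denom_def by (intro smooth_intros smooth_map_linear[OF bounded_linear_diagonal])
  show "spin_denom g \<noteq> 0" if "g \<in> M" for g
    using spin_denom_pos[of g] that assms by force
qed

section \<open>Solving for the angular velocity\<close>

lemma angular_velocity_equation:
  "snd p = (diag_matrix I + (m * r\<^sup>2) *\<^sub>R mat 1) *v w - (m * r\<^sup>2 * (w \<bullet> fst p)) *\<^sub>R fst p
    \<longleftrightarrow> (\<forall>i. w $ i = (snd p $ i + m * r\<^sup>2 * (w \<bullet> fst p) * fst p $ i) / inertia i)"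
proof -
  have "((diag_matrix I + (m * r\<^sup>2) *\<^sub>R mat 1) *v w) $ i = inertia i * w $ i" for i
  proof -
    have "((diag_matrix I + (m * r\<^sup>2) *\<^sub>R mat 1) *v w) $ i
        = (\<Sum>j\<in>UNIV. if j = i then inertia i * w $ i else 0)"
      unfolding matrix_vector_mult_def vec_lambda_beta
      by (intro sum.cong) (auto simp: diag_matrix_def mat_def inertia_def)
    then show ?thesis by simp
  qed
  moreover have "x = inertia i * y - z \<longleftrightarrow> y = (x + z) / inertia i" for i x y z
  proof -
    have "inertia i \<noteq> 0" using inertia_pos[of i] by simp
    then show ?thesis by (auto simp: eq_divide_eq mult.commute)
  qed
  ultimately show ?thesis
    by (simp add: vec_eq_iff del: matrix_vector_mult_add_rdistrib)
qed

text \<open>The system is diagonal once the scalar \<open>s\<close> is regarded as known. Pairing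
  the solution with \<open>g\<close> gives \<open>w \<bullet> g = P + s * Q\<close>, so consistency
  is one linear equation for \<open>s\<close>; its coefficient 1 - c Q equals
  \<open>spin_denom g\<close> because \<open>g\<close> is a unit vector.\<close>

lemma spin_solution:
  fixes g K w :: "real^3"
  assumes g: "g \<bullet> g = 1" and w: "\<And>i. w $ i = (K $ i + s * g $ i) / inertia i"
  shows "m * r\<^sup>2 * (w \<bullet> g) = s \<longleftrightarrow> s = spin_coeff g \<bullet> K"
proof -
  let ?c = "m * r\<^sup>2"
  have nz: "inertia i \<noteq> 0" for i using inertia_pos[of i] by simp
  have "g \<noteq> 0" using g by auto
  then have q: "spin_denom g \<noteq> 0" using spin_denom_pos by force
  define P where "P = (\<Sum>i\<in>UNIV. K $ i * g $ i / inertia i)"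
  define Q where "Q = (\<Sum>i\<in>UNIV. g $ i * g $ i / inertia i)"
  have "I $ i / inertia i * g $ i = g $ i - ?c * (g $ i / inertia i)" for i
  proof -
    have "I $ i = inertia i - ?c" by (simp add: inertia_def)
    then show ?thesis using nz[of i] by (simp add: diff_divide_distrib left_diff_distrib)
  qed
  then have "spin_denom g = (\<Sum>i\<in>UNIV. g $ i * g $ i - ?c * (g $ i * g $ i / inertia i))"
    by (simp add: spin_denom_def inner_vec_def right_diff_distrib mult.left_commute)
  also have "\<dots> = 1 - ?c * Q"
    using g by (simp add: Q_def sum_subtractf inner_vec_def sum_distrib_left)
  finally have denom: "spin_denom g = 1 - ?c * Q" .
  have "w \<bullet> g = (\<Sum>i\<in>UNIV. K $ i * g $ i / inertia i + s * (g $ i * g $ i / inertia i))"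
    by (simp add: inner_vec_def w add_divide_distrib distrib_right mult.assoc)
  also have "\<dots> = P + s * Q"
    by (simp only: P_def Q_def sum.distrib sum_distrib_left)
  finally have wg: "w \<bullet> g = P + s * Q" .
  have "spin_denom g * (spin_coeff g \<bullet> K) = (\<chi> i. ?c / inertia i * g $ i) \<bullet> K"
    using q by (simp add: spin_coeff_def)
  also have "\<dots> = (\<Sum>i\<in>UNIV. ?c * (K $ i * g $ i / inertia i))"
    by (simp add: inner_vec_def mult_ac)
  also have "\<dots> = ?c * P"
    by (simp only: P_def sum_distrib_left)
  finally have "s = spin_coeff g \<bullet> K \<longleftrightarrow> spin_denom g * s = ?c * P"
    using q by (metis mult_cancel_left)
  then show ?thesis
    unfolding denom wg by (auto simp: algebra_simps)
qed

lemma spin_eq: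
  assumes p: "p \<in> phase_space"
  shows "spin p = spin_coeff (fst p) \<bullet> snd p"
proof -
  let ?c = "m * r\<^sup>2" and ?h = "spin_coeff (fst p) \<bullet> snd p"
  let ?eq = "\<lambda>w. \<forall>i. w $ i = (snd p $ i + ?c * (w \<bullet> fst p) * fst p $ i) / inertia i"
  have g: "fst p \<bullet> fst p = 1" using p by (simp add: fst_inner_phase_space)
  define w where "w = (\<chi> i. (snd p $ i + ?h * fst p $ i) / inertia i)"
  have wi: "w $ i = (snd p $ i + ?h * fst p $ i) / inertia i" for i by (simp add: w_def)
  \<comment> \<open>Existence and uniqueness for the definite description use the two directions of
    \<open>spin_solution\<close>: here the solved value of the scalar is shown consistent; below,
    any consistent scalar is shown to be that value.\<close>
  have h: "?c * (w \<bullet> fst p) = ?h" using spin_solution[OF g wi] by simp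
  have "angular_velocity m r I p = w"
    unfolding angular_velocity_def angular_velocity_equation
  proof (rule the_equality)
    show "?eq w" unfolding h using wi by blast
    fix w' assume w': "?eq w'"
    then have "?c * (w' \<bullet> fst p) = ?h" using spin_solution[OF g, of w' "snd p"] by blast
    then show "w' = w" using w' wi by (simp add: vec_eq_iff)
  qed
  then show ?thesis using h by (simp add: spin_def)
qed

section \<open>Smoothness and derivatives of the spin\<close>

lemma nonzero_fst_phase_space: "0 \<notin> fst ` phase_space"
  by (auto simp: phase_space_def)

lemma smooth_map_spin_coeff_fst [smooth_intros]: "smooth_map phase_space (\<lambda>p. spin_coeff (fst p))"
proof -
  show ?thesis unfolding spin_coeff_def
  proof (intro smooth_intros smooth_map_compose_linear[OF bounded_linear_diagonal])
    show "smooth_map phase_space (\<lambda>p. spin_denom (fst p))"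
      unfolding spin_denom_def
      by (intro smooth_intros smooth_map_compose_linear[OF bounded_linear_diagonal])
    show "spin_denom (fst p) \<noteq> 0" if "p \<in> phase_space" for p
      using spin_denom_pos[of "fst p"] that nonzero_fst_phase_space by force
  qed
qed

lemma smooth_map_spin [smooth_intros]: "smooth_map phase_space spin"
proof -
  have "smooth_map phase_space (\<lambda>p. spin_coeff (fst p) \<bullet> snd p)" by (intro smooth_intros)
  then show ?thesis by (rule smooth_map_cong) (simp add: spin_eq)
qed

text \<open>Differentiating \<open>spin_coeff\<close> on the sphere and composing with the
  projection shows that the derivative sees only \<open>fst v\<close>, through a map linear on the
  whole space, as \<open>alternating_sum_tangent\<close> requires.\<close>

lemma deriv_along_spin_coeff:
  assumes p: "p \<in> phase_space"
  obtains D where "linear D"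
    "\<And>v. v \<in> tangent_space phase_space p
      \<Longrightarrow> deriv_along phase_space p v (\<lambda>x. spin_coeff (fst x)) = D (fst v)"
proof -
  obtain D where D: "(spin_coeff has_derivative D) (at (fst p) within fst ` phase_space)"
    using smooth_map_differentiable[OF smooth_map_spin_coeff[OF nonzero_fst_phase_space]] p
    by (auto simp: differentiable_def)
  have "((\<lambda>x. spin_coeff (fst x)) has_derivative (\<lambda>v. D (fst v))) (at p within phase_space)"
    by (rule has_derivative_in_compose[OF has_derivative_fst[OF has_derivative_ident] D])
  then show thesis
    using deriv_along_eqI has_derivative_linear[OF D] that by blast
qed

lemma deriv_along_spin:
  assumes p: "p \<in> phase_space" and v: "v \<in> tangent_space phase_space p"
  shows "deriv_along phase_space p v spin
    = deriv_along phase_space p v (\<lambda>x. spin_coeff (fst x)) \<bullet> snd p + spin_coeff (fst p) \<bullet> snd v"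
proof -
  have "deriv_along phase_space p v spin = deriv_along phase_space p v (\<lambda>x. spin_coeff (fst x) \<bullet> snd x)"
    using p by (intro deriv_along_cong) (auto simp: spin_eq)
  then show ?thesis using p v by (simp add: deriv_along_simps smooth_intros)
qed

text \<open>
  The value of \<open>dB\<close>: the part of the differential of \<open>spin\<close> that comes from the sphere drops out,
  since a 3-form on a tangent plane of the sphere vanishes.
\<close>

definition dB :: "phase \<Rightarrow> phase \<Rightarrow> phase \<Rightarrow> phase \<Rightarrow> real" where
  "dB p u v w = (spin_coeff (fst p) \<bullet> snd u) * area_form p v w
    - (spin_coeff (fst p) \<bullet> snd v) * area_form p u w + (spin_coeff (fst p) \<bullet> snd w) * area_form p u v"

lemma area_form_algebra:
  "area_form p (u + u') v = area_form p u v + area_form p u' v"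
  "area_form p (u - u') v = area_form p u v - area_form p u' v"
  "area_form p u (v + v') = area_form p u v + area_form p u v'"
  "area_form p u (v - v') = area_form p u v - area_form p u v'"
  "area_form p (c *\<^sub>R u) v = c * area_form p u v"
  "area_form p u (c *\<^sub>R v) = c * area_form p u v"
  by (simp_all add: area_form_def cross_add_left cross_add_right left_diff_distrib right_diff_distrib
      inner_add_right inner_diff_right cross_mult_left cross_mult_right Cross3.left_diff_distrib
      Cross3.right_diff_distrib)

lemma area_form_skew: "area_form p v u = - area_form p u v"
  using cross_skew[of "fst v" "fst u"] by (simp add: area_form_def)

lemma dB_algebra:
  "dB p (u + u') v w = dB p u v w + dB p u' v w"
  "dB p (u - u') v w = dB p u v w - dB p u' v w"
  "dB p (c *\<^sub>R u) v w = c * dB p u v w"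
  "dB p v u w = - dB p u v w"
  "dB p u w v = - dB p u v w"
  using area_form_skew[of p v u] area_form_skew[of p w v]
  by (simp_all add: dB_def area_form_algebra inner_add_right inner_diff_right algebra_simps)

lemma smooth_map_area_form [smooth_intros]:
  "smooth_map M X \<Longrightarrow> smooth_map M Y \<Longrightarrow> smooth_map M (\<lambda>x. area_form x (X x) (Y x))"
  unfolding area_form_def by (intro smooth_intros)

lemma smooth_map_dB:
  "smooth_map phase_space X \<Longrightarrow> smooth_map phase_space Y \<Longrightarrow> smooth_map phase_space Z
    \<Longrightarrow> smooth_map phase_space (\<lambda>x. dB x (X x) (Y x) (Z x))"
  unfolding dB_def by (intro smooth_intros)

text \<open>Moving the base point contributes the triple product of three vectors tangent to the
  sphere, which is zero; so the area form differentiates as if its coefficients were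
  constant.\<close>

lemma deriv_along_area_form:
  assumes p: "p \<in> phase_space" and u: "u \<in> tangent_space phase_space p"
    and X: "vector_field phase_space X" and Y: "vector_field phase_space Y"
  shows "deriv_along phase_space p u (\<lambda>x. area_form x (X x) (Y x))
    = area_form p (deriv_along phase_space p u X) (Y p) + area_form p (X p) (deriv_along phase_space p u Y)"
proof -
  note tang = tangent_phase_space_orthogonal[OF p]
  have "fst u \<bullet> cross3 (fst (X p)) (fst (Y p)) = 0"
    using p tang[OF u] tang[OF vector_field_tangent[OF X p]] tang[OF vector_field_tangent[OF Y p]]
    by (intro triple_product_tangent[of "fst p"]) (auto simp: fst_inner_phase_space)
  then show ?thesis
    using p u vector_field_smooth[OF X] vector_field_smooth[OF Y]
    by (simp add: area_form_def deriv_along_simps smooth_intros inner_add_right)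
qed

text \<open>The right-hand side is the wedge of the differential of \<open>spin\<close> with the
  area form. It is the shape produced by the exterior derivative and needed in the Courant bracket,
  while the shape of \<open>dB\<close> is the one used for closedness.\<close>

lemma dB_deriv_spin:
  assumes p: "p \<in> phase_space" and u: "u \<in> tangent_space phase_space p"
    and v: "v \<in> tangent_space phase_space p" and w: "w \<in> tangent_space phase_space p"
  shows "dB p u v w = deriv_along phase_space p u spin * area_form p v w
    - deriv_along phase_space p v spin * area_form p u w
    + deriv_along phase_space p w spin * area_form p u v"
proof -
  let ?M = phase_space
  obtain D where D: "linear D" "\<And>v. v \<in> tangent_space ?M p
      \<Longrightarrow> deriv_along ?M p v (\<lambda>x. spin_coeff (fst x)) = D (fst v)"
    by (rule deriv_along_spin_coeff[OF p]) blast
  have "linear (\<lambda>x. D x \<bullet> snd p)"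
    by (rule linearI) (simp_all add: linear_add[OF D(1)] linear_cmul[OF D(1)] inner_add_left)
  then have "(D (fst u) \<bullet> snd p) * area_form p v w - (D (fst v) \<bullet> snd p) * area_form p u w
      + (D (fst w) \<bullet> snd p) * area_form p u v = 0"
    unfolding area_form_def using p u v w tangent_phase_space_orthogonal[OF p]
    by (intro alternating_sum_tangent) (auto simp: fst_inner_phase_space)
  then show ?thesis
    by (simp add: dB_def deriv_along_spin[OF p] D u v w algebra_simps)
qed

text \<open>All terms with the factor \<open>spin p\<close> make up the exterior derivative of the
  area form, where the derivatives of the extension fields cancel against the Lie brackets; the
  differential of \<open>spin\<close> wedged with the area form remains.\<close>

lemma ext_deriv2_B_form:
  assumes p: "p \<in> phase_space" and u: "u \<in> tangent_space phase_space p"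
    and v: "v \<in> tangent_space phase_space p" and w: "w \<in> tangent_space phase_space p"
  shows "ext_deriv2 phase_space (B_form m r I) p u v w = dB p u v w"
proof -
  let ?M = phase_space
  define X where "X = field_through ?M p u"
  define Y where "Y = field_through ?M p v"
  define Z where "Z = field_through ?M p w"
  have X: "vector_field ?M X" "X p = u" using field_through[OF p u] by (auto simp: X_def)
  have Y: "vector_field ?M Y" "Y p = v" using field_through[OF p v] by (auto simp: Y_def)
  have Z: "vector_field ?M Z" "Z p = w" using field_through[OF p w] by (auto simp: Z_def)
  have B: "B_form m r I = (\<lambda>x u v. spin x * area_form x u v)"
    by (auto simp: fun_eq_iff B_form_def spin_def)
  have deriv: "deriv_along ?M p a (\<lambda>x. spin x * area_form x (V x) (W x))
      = deriv_along ?M p a spin * area_form p (V p) (W p)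
        + spin p * (area_form p (deriv_along ?M p a V) (W p) + area_form p (V p) (deriv_along ?M p a W))"
    if "a \<in> tangent_space ?M p" "vector_field ?M V" "vector_field ?M W" for a V W
    using deriv_along_area_form[OF p that] that(2,3)[THEN vector_field_smooth] that(1) p
    by (simp add: deriv_along_mult smooth_intros)
  have "dB p u v w = deriv_along ?M p u spin * area_form p v w
      - deriv_along ?M p v spin * area_form p u w + deriv_along ?M p w spin * area_form p u v"
    by (rule dB_deriv_spin[OF p u v w])
  moreover have "ext_deriv2 ?M (B_form m r I) p u v w
      = deriv_along ?M p u (\<lambda>x. spin x * area_form x (Y x) (Z x))
        - deriv_along ?M p v (\<lambda>x. spin x * area_form x (X x) (Z x))
        + deriv_along ?M p w (\<lambda>x. spin x * area_form x (X x) (Y x))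
        - spin p * area_form p (lie_bracket ?M X Y p) w
        + spin p * area_form p (lie_bracket ?M X Z p) v
        - spin p * area_form p (lie_bracket ?M Y Z p) u"
    unfolding ext_deriv2_def Let_def B X_def[symmetric] Y_def[symmetric] Z_def[symmetric] ..
  moreover have "lie_bracket ?M X Y p = deriv_along ?M p u Y - deriv_along ?M p v X"
    "lie_bracket ?M X Z p = deriv_along ?M p u Z - deriv_along ?M p w X"
    "lie_bracket ?M Y Z p = deriv_along ?M p v Z - deriv_along ?M p w Y"
    by (simp_all add: lie_bracket_def X Y Z)
  \<comment> \<open>These derivatives stand in the second slot after the product rule but in the
    first slot in the Lie bracket terms.\<close>
  moreover note area_form_skew[of p v "deriv_along ?M p u Z"] area_form_skew[of p u "deriv_along ?M p v Z"]
    area_form_skew[of p u "deriv_along ?M p w Y"]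
  ultimately show ?thesis
    by (simp only: deriv[OF u Y(1) Z(1)] deriv[OF v X(1) Z(1)] deriv[OF w X(1) Y(1)] X(2) Y(2) Z(2)
        area_form_algebra) (simp add: algebra_simps)
qed

section \<open>Closedness of the three-form\<close>

lemma deriv_along_dB:
  assumes p: "p \<in> phase_space" and a: "a \<in> tangent_space phase_space p"
    and X: "vector_field phase_space X" and Y: "vector_field phase_space Y"
    and Z: "vector_field phase_space Z"
  shows "deriv_along phase_space p a (\<lambda>x. dB x (X x) (Y x) (Z x))
    = (deriv_along phase_space p a (\<lambda>x. spin_coeff (fst x)) \<bullet> snd (X p)) * area_form p (Y p) (Z p)
      - (deriv_along phase_space p a (\<lambda>x. spin_coeff (fst x)) \<bullet> snd (Y p)) * area_form p (X p) (Z p)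
      + (deriv_along phase_space p a (\<lambda>x. spin_coeff (fst x)) \<bullet> snd (Z p)) * area_form p (X p) (Y p)
      + dB p (deriv_along phase_space p a X) (Y p) (Z p)
      + dB p (X p) (deriv_along phase_space p a Y) (Z p)
      + dB p (X p) (Y p) (deriv_along phase_space p a Z)"
proof -
  have S: "smooth_map phase_space X" "smooth_map phase_space Y" "smooth_map phase_space Z"
    using X Y Z by (auto intro: vector_field_smooth)
  have deriv: "deriv_along phase_space p a (\<lambda>x. (spin_coeff (fst x) \<bullet> snd (U x)) * area_form x (V x) (W x))
    = (deriv_along phase_space p a (\<lambda>x. spin_coeff (fst x)) \<bullet> snd (U p)) * area_form p (V p) (W p)
      + (spin_coeff (fst p) \<bullet> snd (deriv_along phase_space p a U)) * area_form p (V p) (W p)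
      + (spin_coeff (fst p) \<bullet> snd (U p)) * (area_form p (deriv_along phase_space p a V) (W p)
          + area_form p (V p) (deriv_along phase_space p a W))"
    if "vector_field phase_space U" "vector_field phase_space V" "vector_field phase_space W" for U V W
    using that[THEN vector_field_smooth] deriv_along_area_form[OF p a that(2,3)]
    by (simp add: deriv_along_simps smooth_intros p a algebra_simps)
  show ?thesis
    unfolding dB_def
    by (subst deriv_along_add deriv_along_diff, (intro smooth_intros S p a)+)+
      (simp only: deriv[OF X Y Z] deriv[OF Y X Z] deriv[OF Z X Y], simp add: algebra_simps)
qed

text \<open>Derivatives of the extension fields cancel against the Lie brackets. What is left is
  linear in the \<open>snd\<close> parts of the four vectors, and the coefficient of each is an
  alternating sum over the other three, zero by \<open>alternating_sum_tangent\<close>. Agreement of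
  \<open>\<phi>\<close> with \<open>- dB\<close> on tangent vectors suffices, since the fields and
  their brackets are tangent.\<close>

lemma ext_deriv3_dB:
  assumes p: "p \<in> phase_space" and s: "s \<in> tangent_space phase_space p"
    and u: "u \<in> tangent_space phase_space p" and v: "v \<in> tangent_space phase_space p"
    and w: "w \<in> tangent_space phase_space p"
    and \<phi>: "\<And>x a b c. x \<in> phase_space \<Longrightarrow> a \<in> tangent_space phase_space x
      \<Longrightarrow> b \<in> tangent_space phase_space x \<Longrightarrow> c \<in> tangent_space phase_space x
      \<Longrightarrow> \<phi> x a b c = - dB x a b c"
  shows "ext_deriv3 phase_space \<phi> p s u v w = 0"
proof -
  let ?M = phase_space
  define W where "W = field_through ?M p s"
  define X where "X = field_through ?M p u"
  define Y where "Y = field_through ?M p v"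
  define Z where "Z = field_through ?M p w"
  have W: "vector_field ?M W" "W p = s" using field_through[OF p s] by (auto simp: W_def)
  have X: "vector_field ?M X" "X p = u" using field_through[OF p u] by (auto simp: X_def)
  have Y: "vector_field ?M Y" "Y p = v" using field_through[OF p v] by (auto simp: Y_def)
  have Z: "vector_field ?M Z" "Z p = w" using field_through[OF p w] by (auto simp: Z_def)
  obtain D where D: "linear D" "\<And>v. v \<in> tangent_space ?M p
      \<Longrightarrow> deriv_along ?M p v (\<lambda>x. spin_coeff (fst x)) = D (fst v)"
    by (rule deriv_along_spin_coeff[OF p]) blast
  have deriv: "deriv_along ?M p a (\<lambda>x. \<phi> x (A x) (B x) (C x))
    = - ((D (fst a) \<bullet> snd (A p)) * area_form p (B p) (C p)
      - (D (fst a) \<bullet> snd (B p)) * area_form p (A p) (C p)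
      + (D (fst a) \<bullet> snd (C p)) * area_form p (A p) (B p)
      + dB p (deriv_along ?M p a A) (B p) (C p)
      + dB p (A p) (deriv_along ?M p a B) (C p)
      + dB p (A p) (B p) (deriv_along ?M p a C))"
    if "a \<in> tangent_space ?M p" "vector_field ?M A" "vector_field ?M B" "vector_field ?M C" for a A B C
  proof -
    have "deriv_along ?M p a (\<lambda>x. \<phi> x (A x) (B x) (C x))
        = deriv_along ?M p a (\<lambda>x. - dB x (A x) (B x) (C x))"
      by (intro deriv_along_cong p \<phi>) (use that vector_field_tangent in auto)
    also have "\<dots> = - deriv_along ?M p a (\<lambda>x. dB x (A x) (B x) (C x))"
      using that p by (intro deriv_along_minus smooth_map_dB vector_field_smooth)
    finally show ?thesis
      unfolding deriv_along_dB[OF p that] D(2)[OF that(1)] .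
  qed
  have alt: "(D (fst a) \<bullet> k) * area_form p b c - (D (fst b) \<bullet> k) * area_form p a c
      + (D (fst c) \<bullet> k) * area_form p a b = 0"
    if "a \<in> tangent_space ?M p" "b \<in> tangent_space ?M p" "c \<in> tangent_space ?M p" for a b c k
  proof -
    have "linear (\<lambda>x. D x \<bullet> k)"
      by (rule linearI) (simp_all add: linear_add[OF D(1)] linear_cmul[OF D(1)] inner_add_left)
    then show ?thesis
      unfolding area_form_def using p that[THEN tangent_phase_space_orthogonal[OF p]]
      by (intro alternating_sum_tangent) (auto simp: fst_inner_phase_space)
  qed
  have lie: "\<phi> p (lie_bracket ?M A B p) a b
      = - (dB p (deriv_along ?M p (A p) B) a b - dB p (deriv_along ?M p (B p) A) a b)"
    if "vector_field ?M A" "vector_field ?M B" "a \<in> tangent_space ?M p" "b \<in> tangent_space ?M p"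
    for A B a b
    using \<phi>[OF p vector_field_tangent[OF vector_field_lie_bracket[OF that(1,2)] p] that(3,4)]
    by (simp add: lie_bracket_def dB_algebra(2))
  \<comment> \<open>Moving every differentiated field to the first slot gives the terms the shape in
    which the Lie brackets were expanded.\<close>
  have "dB p a b c = dB p c a b" and "dB p a b c = - dB p b a c" for a b c
    using dB_algebra(4,5)[of p] by (metis minus_minus)+
  then have perm: "dB p a (deriv_along ?M p b V) c = - dB p (deriv_along ?M p b V) a c"
    "dB p a c (deriv_along ?M p b V) = dB p (deriv_along ?M p b V) a c" for a b c V
    by blast+
  have "ext_deriv3 ?M \<phi> p s u v w
      = deriv_along ?M p s (\<lambda>x. \<phi> x (X x) (Y x) (Z x))
         - deriv_along ?M p u (\<lambda>x. \<phi> x (W x) (Y x) (Z x))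
         + deriv_along ?M p v (\<lambda>x. \<phi> x (W x) (X x) (Z x))
         - deriv_along ?M p w (\<lambda>x. \<phi> x (W x) (X x) (Y x))
         - \<phi> p (lie_bracket ?M W X p) v w
         + \<phi> p (lie_bracket ?M W Y p) u w
         - \<phi> p (lie_bracket ?M W Z p) u v
         - \<phi> p (lie_bracket ?M X Y p) s w
         + \<phi> p (lie_bracket ?M X Z p) s v
         - \<phi> p (lie_bracket ?M Y Z p) s u"
    unfolding ext_deriv3_def Let_def W_def[symmetric] X_def[symmetric] Y_def[symmetric] Z_def[symmetric] ..
  moreover note alt[OF u v w, of "snd s"] alt[OF s v w, of "snd u"] alt[OF s u w, of "snd v"]
    alt[OF s u v, of "snd w"]
  ultimately show ?thesis
    by (simp only: deriv[OF s X(1) Y(1) Z(1)] deriv[OF u W(1) Y(1) Z(1)] deriv[OF v W(1) X(1) Z(1)]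
        deriv[OF w W(1) X(1) Y(1)] W X Y Z perm
        lie[OF W(1) X(1) v w] lie[OF W(1) Y(1) u w] lie[OF W(1) Z(1) u v]
        lie[OF X(1) Y(1) s w] lie[OF X(1) Z(1) s v] lie[OF Y(1) Z(1) s u])
qed

lemma closed_three_form_dB:
  "closed_three_form phase_space (\<lambda>p u v w. - ext_deriv2 phase_space (B_form m r I) p u v w)"
  unfolding closed_three_form_def
proof (intro conjI ballI)
  show "ext_deriv3 phase_space (\<lambda>p u v w. - ext_deriv2 phase_space (B_form m r I) p u v w) p s u v w = 0"
    if "p \<in> phase_space" "s \<in> tangent_space phase_space p" "u \<in> tangent_space phase_space p"
      "v \<in> tangent_space phase_space p" "w \<in> tangent_space phase_space p" for p s u v w
    using that by (intro ext_deriv3_dB) (auto simp: ext_deriv2_B_form)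
next
  have closed: "u + u' \<in> tangent_space phase_space p" "c *\<^sub>R u \<in> tangent_space phase_space p"
    if "p \<in> phase_space" "u \<in> tangent_space phase_space p" "u' \<in> tangent_space phase_space p" for p u u' c
    using that by (auto simp: tangent_phase_space inner_add_right)
  show "three_form phase_space (\<lambda>p u v w. - ext_deriv2 phase_space (B_form m r I) p u v w)"
    unfolding three_form_def
  proof (intro conjI ballI allI impI)
    fix X Y Z
    assume "vector_field phase_space X \<and> vector_field phase_space Y \<and> vector_field phase_space Z"
    then have XYZ: "vector_field phase_space X" "vector_field phase_space Y" "vector_field phase_space Z"
      by auto
    then have "smooth_map phase_space (\<lambda>p. - dB p (X p) (Y p) (Z p))"
      by (intro smooth_map_minus smooth_map_dB vector_field_smooth)
    then show "smooth_map phase_space (\<lambda>p. - ext_deriv2 phase_space (B_form m r I) p (X p) (Y p) (Z p))"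
      by (rule smooth_map_cong) (simp add: ext_deriv2_B_form vector_field_tangent XYZ)
  qed (simp_all add: ext_deriv2_B_form closed dB_algebra(1,3), (metis dB_algebra(4,5) minus_minus)+)
qed

section \<open>The bracket and its bivector field\<close>

definition momentum_shift :: "phase \<Rightarrow> real^3" where
  "momentum_shift p = snd p - spin p *\<^sub>R fst p"

text \<open>The bracket formula with the two gradient pairs replaced by arbitrary ambient
  vectors.\<close>

definition pairing :: "phase \<Rightarrow> phase \<Rightarrow> phase \<Rightarrow> real" where
  "pairing p a b = - (momentum_shift p \<bullet> cross3 (snd a) (snd b))
     - fst p \<bullet> (cross3 (snd a) (fst b) - cross3 (snd b) (fst a))"

definition hamiltonian :: "phase \<Rightarrow> phase \<Rightarrow> phase" where
  "hamiltonian p a = (cross3 (snd a) (fst p), cross3 (snd a) (momentum_shift p) + cross3 (fst a) (fst p))"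

lemma pairing_hamiltonian: "pairing p a b = b \<bullet> hamiltonian p a"
  by (simp add: pairing_def hamiltonian_def inner_prod_def cross3_simps)

lemma pairing_skew: "pairing p b a = - pairing p a b"
  by (simp add: pairing_def cross3_simps)

lemma pairing_add: "pairing p (a + a') b = pairing p a b + pairing p a' b"
  and pairing_scaleR: "pairing p (c *\<^sub>R a) b = c * pairing p a b"
  by (simp_all add: pairing_def cross3_simps)

lemma hamiltonian_tangent: "p \<in> phase_space \<Longrightarrow> hamiltonian p a \<in> tangent_space phase_space p"
  by (simp add: tangent_phase_space hamiltonian_def dot_cross_self)

lemma smooth_map_momentum_shift [smooth_intros]: "smooth_map phase_space momentum_shift"
  unfolding momentum_shift_def by (intro smooth_intros)

lemma smooth_map_pairing:
  "smooth_map phase_space a \<Longrightarrow> smooth_map phase_space b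
    \<Longrightarrow> smooth_map phase_space (\<lambda>p. pairing p (a p) (b p))"
  unfolding pairing_def by (intro smooth_intros)

text \<open>The second argument is only paired with a Hamiltonian vector, which is tangent;
  skew-symmetry carries this over to the first. It is the Casimir property of the squared norm of
  gamma: multiples of \<open>(fst p, 0)\<close> are invisible.\<close>

lemma pairing_cong:
  assumes p: "p \<in> phase_space"
    and a: "\<And>v. v \<in> tangent_space phase_space p \<Longrightarrow> a \<bullet> v = a' \<bullet> v"
    and b: "\<And>v. v \<in> tangent_space phase_space p \<Longrightarrow> b \<bullet> v = b' \<bullet> v"
  shows "pairing p a b = pairing p a' b'"
proof -
  have "pairing p a b = pairing p a b'"
    using b[OF hamiltonian_tangent[OF p]] by (simp add: pairing_hamiltonian)
  also have "\<dots> = - pairing p b' a" by (rule pairing_skew)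
  also have "\<dots> = - pairing p b' a'"
    using a[OF hamiltonian_tangent[OF p]] by (simp add: pairing_hamiltonian)
  also have "\<dots> = pairing p a' b'" by (rule pairing_skew[symmetric])
  finally show ?thesis .
qed

section \<open>The bivector field of the bracket\<close>

definition bivector :: "phase \<Rightarrow> (phase \<Rightarrow> real) \<Rightarrow> (phase \<Rightarrow> real) \<Rightarrow> real" where
  "bivector p a b = pairing p (covector_rep p a) (covector_rep p b)"

lemma bivector_field_bivector: "bivector_field phase_space bivector"
  unfolding bivector_field_def
proof (intro conjI ballI allI impI)
  show "smooth_map phase_space (\<lambda>p. bivector p (\<alpha> p) (\<beta> p))"
    if "one_form phase_space \<alpha> \<and> one_form phase_space \<beta>" for \<alpha> \<beta>
    unfolding bivector_def using that by (intro smooth_map_pairing smooth_map_covector_rep) auto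
next
  fix p a a' b c assume p: "p \<in> phase_space"
  have "covector_rep p (\<lambda>v\<in>tangent_space phase_space p. a v + a' v) = covector_rep p a + covector_rep p a'"
    by (simp add: covector_rep_def tangent_proj_tangent[OF p] scaleR_left_distrib sum.distrib)
  then show "bivector p (\<lambda>v\<in>tangent_space phase_space p. a v + a' v) b = bivector p a b + bivector p a' b"
    by (simp add: bivector_def pairing_add)
  have "covector_rep p (\<lambda>v\<in>tangent_space phase_space p. c * a v) = c *\<^sub>R covector_rep p a"
    by (simp add: covector_rep_def tangent_proj_tangent[OF p] scaleR_sum_right)
  then show "bivector p (\<lambda>v\<in>tangent_space phase_space p. c * a v) b = c * bivector p a b"
    by (simp add: bivector_def pairing_scaleR)
  show "bivector p b a = - bivector p a b"
    unfolding bivector_def by (rule pairing_skew)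
qed

lemma differential_cotangent:
  assumes "smooth_map phase_space f" "p \<in> phase_space"
  shows "differential phase_space f p \<in> cotangent_space phase_space p"
  using linear_add[OF deriv_along_linear[OF assms]] linear_cmul[OF deriv_along_linear[OF assms]] assms(2)
  by (auto simp: differential_def cotangent_space_def tangent_phase_space inner_add_right
      simp del: add_Pair scaleR_Pair split_paired_All)

lemma one_form_differential:
  assumes "smooth_map phase_space f"
  shows "one_form phase_space (differential phase_space f)"
  unfolding one_form_def
proof (intro conjI ballI allI impI)
  fix X assume X: "vector_field phase_space X"
  have "smooth_map phase_space (\<lambda>p. deriv_along phase_space p (X p) f)"
    using X by (intro smooth_map_deriv_along assms) (auto simp: vector_field_def)
  then show "smooth_map phase_space (\<lambda>p. differential phase_space f p (X p))"
    by (rule smooth_map_cong) (simp add: differential_def vector_field_tangent[OF X])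
qed (rule differential_cotangent[OF assms])

lemma linear_inner_representation:
  fixes D :: "phase \<Rightarrow> real"
  assumes "linear D"
  shows "D v = ((\<chi> i. D (axis i 1, 0)), (\<chi> i. D (0, axis i 1))) \<bullet> v"
proof -
  have eq: "v = (\<Sum>i\<in>UNIV. (fst v $ i) *\<^sub>R (axis i 1, 0)) + (\<Sum>i\<in>UNIV. (snd v $ i) *\<^sub>R (0, axis i 1))"
    by (simp add: prod_eq_iff fst_sum snd_sum basis_expansion scalar_mult_eq_scaleR[symmetric])
  have "D v = (\<Sum>i\<in>UNIV. (fst v $ i) * D (axis i 1, 0)) + (\<Sum>i\<in>UNIV. (snd v $ i) * D (0, axis i 1))"
    by (subst eq) (simp add: linear_add[OF assms] linear_sum[OF assms] linear_cmul[OF assms] del: scaleR_Pair)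
  then show ?thesis
    by (simp add: inner_prod_def inner_vec_def mult.commute)
qed

text \<open>The gradient of the chosen extension and the canonical representative of the
  differential agree on tangent vectors, so \<open>pairing_cong\<close> exchanges them. This removes
  the choice of extensions and reduces the almost Poisson axioms to algebra of
  \<open>pairing\<close> and rules for differentials.\<close>

lemma rank2_bracket_bivector:
  assumes f: "smooth_map phase_space f" and g: "smooth_map phase_space g" and p: "p \<in> phase_space"
  shows "rank2_bracket m r I f g p
    = bivector p (differential phase_space f p) (differential phase_space g p)"
proof -
  define ext where "ext f = (SOME F. smooth_extension_of phase_space f F)" for f :: "phase \<Rightarrow> real"
  have rep: "(grad_gamma (ext f) p, grad_K (ext f) p) \<bullet> v
      = covector_rep p (differential phase_space f p) \<bullet> v"
    if f: "smooth_map phase_space f" and v: "v \<in> tangent_space phase_space p" for f v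
  proof -
    have "smooth_extension_of phase_space f (ext f)"
      unfolding ext_def using f smooth_map_def someI_ex by metis
    then obtain U where U: "open U" "phase_space \<subseteq> U" "smooth_on U (ext f)"
      "\<And>x. x \<in> phase_space \<Longrightarrow> ext f x = f x"
      unfolding smooth_extension_of_def by blast
    have "linear (frechet_derivative (ext f) (at p))"
      using smooth_on_has_derivative[OF U(3)] U(2) p has_derivative_linear by blast
    then have "(grad_gamma (ext f) p, grad_K (ext f) p) \<bullet> v = frechet_derivative (ext f) (at p) v"
      unfolding grad_gamma_def grad_K_def by (rule linear_inner_representation[symmetric])
    also have "\<dots> = deriv_along phase_space p v f"
      using deriv_along_extension[OF U p v] by simp
    also have "\<dots> = differential phase_space f p v"
      by (simp add: differential_def v)
    also have "\<dots> = covector_rep p (differential phase_space f p) \<bullet> v"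
      by (rule covector_rep_inner[OF p differential_cotangent[OF f p] v])
    finally show ?thesis .
  qed
  have "rank2_bracket m r I f g p
      = pairing p (grad_gamma (ext f) p, grad_K (ext f) p) (grad_gamma (ext g) p, grad_K (ext g) p)"
    by (simp add: rank2_bracket_def rank2_formula_def Let_def pairing_def momentum_shift_def spin_def ext_def)
  also have "\<dots> = bivector p (differential phase_space f p) (differential phase_space g p)"
    unfolding bivector_def by (rule pairing_cong[OF p rep[OF f] rep[OF g]])
  finally show ?thesis .
qed

lemma associated_bivector_rank2:
  "associated_bivector phase_space (rank2_bracket m r I) bivector"
  unfolding associated_bivector_def
  using bivector_field_bivector rank2_bracket_bivector by auto

lemma covector_rep_differential:
  fixes f g :: "phase \<Rightarrow> real"
  assumes p: "p \<in> phase_space" and f: "smooth_map phase_space f" and g: "smooth_map phase_space g"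
  shows "covector_rep p (differential phase_space (\<lambda>x. f x + g x) p)
      = covector_rep p (differential phase_space f p) + covector_rep p (differential phase_space g p)"
    and "covector_rep p (differential phase_space (\<lambda>x. c * f x) p)
      = c *\<^sub>R covector_rep p (differential phase_space f p)"
    and "covector_rep p (differential phase_space (\<lambda>x. f x * g x) p)
      = f p *\<^sub>R covector_rep p (differential phase_space g p)
        + g p *\<^sub>R covector_rep p (differential phase_space f p)"
  using f g tangent_proj_tangent[OF p]
  by (simp_all add: covector_rep_def differential_def deriv_along_simps smooth_intros p
      scaleR_left_distrib sum.distrib scaleR_sum_right mult.commute)

lemma almost_poisson_rank2: "almost_poisson phase_space (rank2_bracket m r I)"
  unfolding almost_poisson_def
proof (intro conjI allI impI ballI)
  fix f f' g g' :: "phase \<Rightarrow> real" and p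
  assume as: "smooth_map phase_space f \<and> smooth_map phase_space g \<and>
      (\<forall>p\<in>phase_space. f p = f' p \<and> g p = g' p)" and p: "p \<in> phase_space"
  then have "smooth_map phase_space f'" "smooth_map phase_space g'"
    using smooth_map_cong by blast+
  moreover have "differential phase_space f p = differential phase_space f' p"
    "differential phase_space g p = differential phase_space g' p"
    unfolding differential_def
    using deriv_along_cong[OF p, of f f'] deriv_along_cong[OF p, of g g'] as by auto
  ultimately show "rank2_bracket m r I f g p = rank2_bracket m r I f' g' p"
    using as p by (simp add: rank2_bracket_bivector)
next
  fix f g :: "phase \<Rightarrow> real"
  assume fg: "smooth_map phase_space f \<and> smooth_map phase_space g"
  have "smooth_map phase_space
      (\<lambda>p. bivector p (differential phase_space f p) (differential phase_space g p))"
    unfolding bivector_def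
    using fg by (intro smooth_map_pairing smooth_map_covector_rep one_form_differential) auto
  then show "smooth_map phase_space (rank2_bracket m r I f g)"
    by (rule smooth_map_cong) (use fg rank2_bracket_bivector in simp)
  show "rank2_bracket m r I g f p = - rank2_bracket m r I f g p" if "p \<in> phase_space" for p
    using pairing_skew[of p "covector_rep p (differential phase_space g p)"] fg that
    by (simp add: rank2_bracket_bivector bivector_def)
next
  fix f g h :: "phase \<Rightarrow> real" and c p
  assume fgh: "smooth_map phase_space f \<and> smooth_map phase_space g \<and> smooth_map phase_space h"
    and p: "p \<in> phase_space"
  then have s: "smooth_map phase_space (\<lambda>x. f x + g x)" "smooth_map phase_space (\<lambda>x. c * f x)"
    "smooth_map phase_space (\<lambda>x. f x * g x)"
    by (auto intro: smooth_intros)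
  show "rank2_bracket m r I (\<lambda>x. f x + g x) h p = rank2_bracket m r I f h p + rank2_bracket m r I g h p"
    and "rank2_bracket m r I (\<lambda>x. c * f x) h p = c * rank2_bracket m r I f h p"
    and "rank2_bracket m r I (\<lambda>x. f x * g x) h p
      = f p * rank2_bracket m r I g h p + g p * rank2_bracket m r I f h p"
    using fgh p s
    by (simp_all add: rank2_bracket_bivector bivector_def covector_rep_differential pairing_add pairing_scaleR)
qed

text \<open>The vector \<open>e\<close> may be any ambient representative of the covector: both the
  Courant covector, which need not be in canonical form, and \<open>covector_rep\<close> are used
  for it.\<close>

lemma sharp_eq:
  assumes p: "p \<in> phase_space" and a: "a \<in> cotangent_space phase_space p"
    and e: "\<And>v. v \<in> tangent_space phase_space p \<Longrightarrow> a v = e \<bullet> v"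
  shows "sharp phase_space bivector p a = hamiltonian p e"
  unfolding sharp_def
proof (rule the_equality)
  have "b (hamiltonian p e) = bivector p a b" if b: "b \<in> cotangent_space phase_space p" for b
  proof -
    have "b (hamiltonian p e) = pairing p e (covector_rep p b)"
      using covector_rep_inner[OF p b hamiltonian_tangent[OF p]] by (simp add: pairing_hamiltonian)
    also have "\<dots> = bivector p a b"
      unfolding bivector_def using e covector_rep_inner[OF p a] by (intro pairing_cong[OF p]) auto
    finally show ?thesis .
  qed
  then show *: "hamiltonian p e \<in> tangent_space phase_space p \<and>
      (\<forall>b\<in>cotangent_space phase_space p. b (hamiltonian p e) = bivector p a b)"
    using hamiltonian_tangent[OF p] by blast
  fix w assume w: "w \<in> tangent_space phase_space p \<and>
      (\<forall>b\<in>cotangent_space phase_space p. b w = bivector p a b)"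
  \<comment> \<open>Restrictions of ambient inner products are already enough covectors to separate
    tangent vectors.\<close>
  have "y \<bullet> w = y \<bullet> hamiltonian p e" for y
    using bspec[OF conjunct2[OF w] restrict_inner_cotangent[OF p, of y]]
      bspec[OF conjunct2[OF *] restrict_inner_cotangent[OF p, of y]] w hamiltonian_tangent[OF p]
    by simp
  then show "w = hamiltonian p e"
    by (metis vector_eq_ldot)
qed

section \<open>Closure under the twisted Courant bracket\<close>

lemma smooth_map_hamiltonian:
  "smooth_map phase_space a \<Longrightarrow> smooth_map phase_space (\<lambda>p. hamiltonian p (a p))"
  unfolding hamiltonian_def by (intro smooth_intros)

lemma hamiltonian_add: "hamiltonian p (a + b) = hamiltonian p a + hamiltonian p b"
  and hamiltonian_diff: "hamiltonian p (a - b) = hamiltonian p a - hamiltonian p b"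
  by (simp_all add: hamiltonian_def cross3_distribs)

lemma deriv_along_hamiltonian:
  assumes a: "smooth_map phase_space a" and p: "p \<in> phase_space"
    and v: "v \<in> tangent_space phase_space p"
  shows "deriv_along phase_space p v (\<lambda>x. hamiltonian x (a x))
    = hamiltonian p (deriv_along phase_space p v a)
      + (cross3 (snd (a p)) (fst v),
         cross3 (snd (a p)) (snd v - deriv_along phase_space p v spin *\<^sub>R fst p - spin p *\<^sub>R fst v)
           + cross3 (fst (a p)) (fst v))"
proof -
  have "deriv_along phase_space p v momentum_shift
      = snd v - deriv_along phase_space p v spin *\<^sub>R fst p - spin p *\<^sub>R fst v"
    unfolding momentum_shift_def using p v by (simp add: deriv_along_simps smooth_intros)
  then show ?thesis
    unfolding hamiltonian_def using a p v
    by (simp add: deriv_along_Pair deriv_along_simps smooth_intros add_ac)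
qed

text \<open>
  The covector part of the twisted Courant bracket. The derivatives of \<open>spin\<close> in the direction of
  the argument cancel between the Lie derivative of the bivector and \<open>\<phi>\<close>; only those along the two
  Hamiltonian fields are left.
\<close>

definition bracket_covector :: "(phase \<Rightarrow> phase) \<Rightarrow> (phase \<Rightarrow> phase) \<Rightarrow> phase \<Rightarrow> phase" where
  "bracket_covector a b p = (let X = hamiltonian p (a p); Y = hamiltonian p (b p) in
     deriv_along phase_space p X b - deriv_along phase_space p Y a
     + (cross3 (fst (b p)) (snd (a p)) + cross3 (snd (b p)) (fst (a p))
          - spin p *\<^sub>R cross3 (snd (b p)) (snd (a p))
          - deriv_along phase_space p X spin *\<^sub>R cross3 (fst p) (fst Y)
          + deriv_along phase_space p Y spin *\<^sub>R cross3 (fst p) (fst X),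
        cross3 (snd (b p)) (snd (a p))))"

lemma smooth_map_bracket_covector:
  assumes a: "smooth_map phase_space a" and b: "smooth_map phase_space b"
  shows "smooth_map phase_space (bracket_covector a b)"
  unfolding bracket_covector_def Let_def
  by (intro smooth_map_add smooth_map_diff smooth_map_Pair smooth_map_deriv_along
      smooth_map_hamiltonian smooth_intros a b hamiltonian_tangent)

text \<open>Derivatives of \<open>a\<close> and \<open>b\<close> match by linearity of
  \<open>hamiltonian\<close>, and those of \<open>spin\<close> by \<open>cross3_sandwich\<close>.
  The rest consists of nested cross products, combined by the Jacobi identity for the pairs of
  momentum parts and of one momentum part with one gamma part.\<close>

lemma lie_bracket_hamiltonian:
  assumes p: "p \<in> phase_space"
    and a: "smooth_map phase_space a" and b: "smooth_map phase_space b"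
    and X: "\<And>x. x \<in> phase_space \<Longrightarrow> X x = hamiltonian x (a x)"
    and Y: "\<And>x. x \<in> phase_space \<Longrightarrow> Y x = hamiltonian x (b x)"
  shows "lie_bracket phase_space X Y p = hamiltonian p (bracket_covector a b p)"
proof -
  let ?M = phase_space
  have g: "fst p \<bullet> fst p = 1" using p by (simp add: fst_inner_phase_space)
  define u where "u = hamiltonian p (a p)"
  define v where "v = hamiltonian p (b p)"
  have tang: "u \<in> tangent_space ?M p" "v \<in> tangent_space ?M p"
    by (simp_all add: u_def v_def hamiltonian_tangent p)
  have comps: "fst u = cross3 (snd (a p)) (fst p)"
    "snd u = cross3 (snd (a p)) (momentum_shift p) + cross3 (fst (a p)) (fst p)"
    "fst v = cross3 (snd (b p)) (fst p)"
    "snd v = cross3 (snd (b p)) (momentum_shift p) + cross3 (fst (b p)) (fst p)"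
    by (simp_all add: u_def v_def hamiltonian_def)
  have "lie_bracket ?M X Y p = deriv_along ?M p u (\<lambda>x. hamiltonian x (b x))
      - deriv_along ?M p v (\<lambda>x. hamiltonian x (a x))"
    unfolding lie_bracket_def X[OF p] Y[OF p] u_def[symmetric] v_def[symmetric]
    using deriv_along_cong[OF p Y] deriv_along_cong[OF p X] by simp
  also have "\<dots> = hamiltonian p (deriv_along ?M p u b) - hamiltonian p (deriv_along ?M p v a)
      + (cross3 (snd (b p)) (fst u) - cross3 (snd (a p)) (fst v),
         cross3 (snd (b p)) (snd u - deriv_along ?M p u spin *\<^sub>R fst p - spin p *\<^sub>R fst u)
           + cross3 (fst (b p)) (fst u)
         - cross3 (snd (a p)) (snd v - deriv_along ?M p v spin *\<^sub>R fst p - spin p *\<^sub>R fst v)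
           - cross3 (fst (a p)) (fst v))"
    by (simp add: deriv_along_hamiltonian[OF b p tang(1)] deriv_along_hamiltonian[OF a p tang(2)]
        prod_eq_iff)
  also have "\<dots> = hamiltonian p (bracket_covector a b p)"
    unfolding bracket_covector_def Let_def u_def[symmetric] v_def[symmetric] hamiltonian_add hamiltonian_diff
    unfolding hamiltonian_def comps fst_conv snd_conv
    by (simp add: cross3_distribs cross3_sandwich[OF g] scaleR_diff_right scaleR_add_right
        cross3_Jacobi[of "snd (b p)" "snd (a p)"] cross3_Jacobi[of "snd (b p)" "fst (a p)"]
        cross3_Jacobi[of "fst (b p)" "snd (a p)"])
  finally show ?thesis .
qed

text \<open>This is where the twist is forced. The Lie and exterior derivatives leave the derivative
  of \<open>spin\<close> along \<open>v\<close> times the area form of the two Hamiltonian vectors,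
  and subtracting dB removes exactly that term.\<close>

lemma courant_covector:
  assumes p: "p \<in> phase_space" and v: "v \<in> tangent_space phase_space p"
    and a: "smooth_map phase_space a" and b: "smooth_map phase_space b"
    and X: "vector_field phase_space X" "\<And>x. x \<in> phase_space \<Longrightarrow> X x = hamiltonian x (a x)"
    and Y: "vector_field phase_space Y" "\<And>x. x \<in> phase_space \<Longrightarrow> Y x = hamiltonian x (b x)"
    and \<alpha>: "\<And>x u. x \<in> phase_space \<Longrightarrow> u \<in> tangent_space phase_space x \<Longrightarrow> \<alpha> x u = a x \<bullet> u"
    and \<beta>: "\<And>x u. x \<in> phase_space \<Longrightarrow> u \<in> tangent_space phase_space x \<Longrightarrow> \<beta> x u = b x \<bullet> u"
  shows "lie_deriv1 phase_space X \<beta> p v - ext_deriv1 phase_space \<alpha> p (Y p) v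
      - ext_deriv2 phase_space (B_form m r I) p (X p) (Y p) v = bracket_covector a b p \<bullet> v"
proof -
  let ?M = phase_space
  have g: "fst p \<bullet> fst p = 1" using p by (simp add: fst_inner_phase_space)
  have Xp: "X p \<in> tangent_space ?M p" and Yp: "Y p \<in> tangent_space ?M p"
    using vector_field_tangent p X(1) Y(1) by blast+
  define s where "s = deriv_along ?M p v spin"
  define ag where "ag = fst (a p)"
  define aK where "aK = snd (a p)"
  define bg where "bg = fst (b p)"
  define bK where "bK = snd (b p)"
  define d where "d = deriv_along ?M p v a"
  have fX: "fst (X p) = cross3 aK (fst p)" and fY: "fst (Y p) = cross3 bK (fst p)"
    by (simp_all add: X Y p hamiltonian_def aK_def bK_def)
  have "deriv_along ?M p v X = deriv_along ?M p v (\<lambda>x. hamiltonian x (a x))"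
    by (rule deriv_along_cong[OF p X(2)])
  then have "b p \<bullet> deriv_along ?M p v X = pairing p d (b p)
      + bg \<bullet> cross3 aK (fst v) + bK \<bullet> (cross3 aK (snd v - s *\<^sub>R fst p - spin p *\<^sub>R fst v) + cross3 ag (fst v))"
    by (simp add: deriv_along_hamiltonian[OF a p v] inner_add_right pairing_hamiltonian d_def s_def
        inner_prod_def[of "b p" "(_, _)"] aK_def ag_def bK_def bg_def)
  \<comment> \<open>By skew-symmetry the derivative of the representative \<open>a\<close> in the
    direction \<open>v\<close> drops out of the sum of Lie and exterior derivative terms.\<close>
  moreover have "d \<bullet> Y p = - pairing p d (b p)"
    using pairing_skew[of p d "b p"] by (simp add: Y(2)[OF p] pairing_hamiltonian)
  ultimately have "b p \<bullet> deriv_along ?M p v X + d \<bullet> Y p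
      = bg \<bullet> cross3 aK (fst v) + bK \<bullet> (cross3 aK (snd v - s *\<^sub>R fst p - spin p *\<^sub>R fst v) + cross3 ag (fst v))"
    by simp
  also have "\<dots> = (cross3 bg aK + cross3 bK ag - spin p *\<^sub>R cross3 bK aK) \<bullet> fst v + cross3 bK aK \<bullet> snd v
      + s * (fst p \<bullet> cross3 aK bK)"
    by (simp add: cross3_simps)
  finally have 1: "b p \<bullet> deriv_along ?M p v X + d \<bullet> Y p
      = (cross3 bg aK + cross3 bK ag - spin p *\<^sub>R cross3 bK aK) \<bullet> fst v + cross3 bK aK \<bullet> snd v
        + s * (fst p \<bullet> cross3 aK bK)" .
  have 2: "ext_deriv2 ?M (B_form m r I) p (X p) (Y p) v
      = deriv_along ?M p (X p) spin * (cross3 (fst p) (fst (Y p)) \<bullet> fst v)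
        - deriv_along ?M p (Y p) spin * (cross3 (fst p) (fst (X p)) \<bullet> fst v)
        + s * (fst p \<bullet> cross3 aK bK)"
  proof -
    \<comment> \<open>This identifies the coefficient of \<open>s\<close> in dB with the one found
      for the untwisted terms.\<close>
    have "area_form p (X p) (Y p) = fst p \<bullet> cross3 aK bK"
      unfolding area_form_def fX fY by (rule cross3_triple_unit[OF g])
    moreover have "area_form p u v = cross3 (fst p) (fst u) \<bullet> fst v" for u
      by (simp add: area_form_def cross3_simps)
    ultimately show ?thesis
      using ext_deriv2_B_form[OF p Xp Yp v] dB_deriv_spin[OF p Xp Yp v] by (simp add: s_def)
  qed
  have 3: "bracket_covector a b p \<bullet> v = deriv_along ?M p (X p) b \<bullet> v - deriv_along ?M p (Y p) a \<bullet> v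
      + (cross3 bg aK + cross3 bK ag - spin p *\<^sub>R cross3 bK aK) \<bullet> fst v + cross3 bK aK \<bullet> snd v
      - deriv_along ?M p (X p) spin * (cross3 (fst p) (fst (Y p)) \<bullet> fst v)
      + deriv_along ?M p (Y p) spin * (cross3 (fst p) (fst (X p)) \<bullet> fst v)"
    unfolding bracket_covector_def Let_def X(2)[OF p, symmetric] Y(2)[OF p, symmetric]
    by (simp add: inner_add_left inner_diff_left inner_prod_def[of "(_, _)" v] aK_def ag_def bK_def bg_def)
  have "lie_deriv1 ?M X \<beta> p v = deriv_along ?M p (X p) b \<bullet> v + b p \<bullet> deriv_along ?M p v X"
    by (rule lie_deriv1_inner[OF p v X(1) b]) (rule \<beta>)
  moreover have "ext_deriv1 ?M \<alpha> p (Y p) v = deriv_along ?M p (Y p) a \<bullet> v - d \<bullet> Y p"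
    unfolding d_def by (rule ext_deriv1_inner[OF p Yp v a]) (rule \<alpha>)
  ultimately show ?thesis
    using 1 2 3 by simp
qed

lemma twisted_courant_bracket_closed:
  assumes "(X, \<alpha>) \<in> graph_sections phase_space bivector" "(Y, \<beta>) \<in> graph_sections phase_space bivector"
  shows "twisted_courant_bracket phase_space
      (\<lambda>p u v w. - ext_deriv2 phase_space (B_form m r I) p u v w) (X, \<alpha>) (Y, \<beta>)
    \<in> graph_sections phase_space bivector"
proof -
  let ?M = phase_space
  define a where "a p = covector_rep p (\<alpha> p)" for p
  define b where "b p = covector_rep p (\<beta> p)" for p
  have X: "vector_field ?M X" and \<alpha>: "one_form ?M \<alpha>" and Y: "vector_field ?M Y" and \<beta>: "one_form ?M \<beta>"
    and sharp: "\<And>p. p \<in> ?M \<Longrightarrow> X p = sharp ?M bivector p (\<alpha> p)"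
      "\<And>p. p \<in> ?M \<Longrightarrow> Y p = sharp ?M bivector p (\<beta> p)"
    using assms by (auto simp: graph_sections_def)
  have ct: "\<alpha> p \<in> cotangent_space ?M p" "\<beta> p \<in> cotangent_space ?M p" if "p \<in> ?M" for p
    using \<alpha> \<beta> that by (auto simp: one_form_def)
  have smooth: "smooth_map ?M a" "smooth_map ?M b"
    unfolding a_def b_def by (intro smooth_map_covector_rep \<alpha> \<beta>)+
  have rep: "\<alpha> p v = a p \<bullet> v" "\<beta> p v = b p \<bullet> v" if "p \<in> ?M" "v \<in> tangent_space ?M p" for p v
    unfolding a_def b_def by (intro covector_rep_inner that ct)+
  have ham: "X p = hamiltonian p (a p)" "Y p = hamiltonian p (b p)" if "p \<in> ?M" for p
    using sharp[OF that] sharp_eq[OF that ct(1)[OF that] rep(1)[OF that]]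
      sharp_eq[OF that ct(2)[OF that] rep(2)[OF that]] by auto
  define e where "e = bracket_covector a b"
  define \<eta> where "\<eta> = (\<lambda>p. \<lambda>v\<in>tangent_space ?M p. lie_deriv1 ?M X \<beta> p v - ext_deriv1 ?M \<alpha> p (Y p) v
      + - ext_deriv2 ?M (B_form m r I) p (X p) (Y p) v)"
  \<comment> \<open>Both sides are restricted to the tangent space, so agreement on tangent vectors
    is equality of covectors; smoothness and the value of \<open>sharp\<close> can then be read off
    from \<open>e\<close>.\<close>
  have \<eta>: "\<eta> p = (\<lambda>v\<in>tangent_space ?M p. e p \<bullet> v)" if "p \<in> ?M" for p
    unfolding \<eta>_def e_def
    using courant_covector[OF that _ smooth X ham(1) Y ham(2) rep] by (intro restrict_ext) simp
  have "one_form ?M (\<lambda>p. \<lambda>v\<in>tangent_space ?M p. e p \<bullet> v)"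
    unfolding e_def by (intro one_form_restrict_inner smooth_map_bracket_covector smooth)
  then have "one_form ?M \<eta>"
    by (rule one_form_cong) (simp add: \<eta>)
  moreover have "lie_bracket ?M X Y p = sharp ?M bivector p (\<eta> p)" if p: "p \<in> ?M" for p
  proof -
    have "sharp ?M bivector p (\<eta> p) = hamiltonian p (e p)"
      unfolding \<eta>[OF p] by (rule sharp_eq[OF p restrict_inner_cotangent[OF p]]) simp
    also have "\<dots> = lie_bracket ?M X Y p"
      unfolding e_def by (rule lie_bracket_hamiltonian[OF p smooth ham, symmetric])
    finally show ?thesis by simp
  qed
  ultimately show ?thesis
    using vector_field_lie_bracket[OF X Y]
    by (simp add: graph_sections_def twisted_courant_bracket_def \<eta>_def)
qed

end

theorem theorem5p7:
  fixes m r :: real and I :: "real^3"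
  assumes "0 < m" and "0 < r" and "\<And>i. 0 < I $ i"
  shows "twisted_poisson phase_space (rank2_bracket m r I)
           (\<lambda>p u v w. - ext_deriv2 phase_space (B_form m r I) p u v w)"
proof -
  interpret rank2_ball m r I by unfold_locales fact+
  show ?thesis
    unfolding twisted_poisson_def
    using almost_poisson_rank2 closed_three_form_dB associated_bivector_rank2 twisted_courant_bracket_closed
    by (intro conjI exI[of _ bivector]) auto
qed

end
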